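(* Let $P(\lambda)=\sum_{i=0}^m\lambda^iA_i$ with $A_i\in\mathbb{C}^{n\times n}$, $A_m\neq 0$, $m\ge 2$, be regular and suppose that $\infty$ is an eigenvalue of $P(\lambda)$. Let $$L(\lambda)=M_{\tau_1}(Y_1)\,M_{\sigma_1}(X_1)\,(\lambda M^P_\tau-M^P_\sigma)\,M_{\sigma_2}(X_2)\,M_{\tau_2}(Y_2)$$ be an extended generalized Fiedler pencil (EGFP) of $P(\lambda)$. Let $Z$ be an $mn\times k$ matrix with $\mathrm{rank}(Z)=k$. Right eigenvectors: if $Z$ is a basis of the right eigenspace of $L(\lambda)$ at $\infty$, then (a) if $c_{-m}(\tau)<m$, then $(e^T_{c_{-m}(\tau,\tau_2)+1}\otimes I_n)Z$ is a basis of the right eigenspace of $P(\lambda)$ at $\infty$; (b) if $c_{-m}(\tau)=m$, then $A_0^{-1}(e_m^T\otimes I_n)Z$ is a basis of the right eigenspace of $P(\lambda)$ at $\infty$. Left eigenvectors: if $Z$ is a basis of the left eigenspace of $L(\lambda)$ at $\infty$, then (c) if $i_{-m}(\tau)<m$, then $(e^T_{i_{-m}(\tau_1,\tau)+1}\otimes I_n)Z$ is a basis of the left eigenspace of $P(\lambda)$ at $\infty$; (d) if $i_{-m}(\tau)=m$, then $A_0^{-T}(e_m^T\otimes I_n)Z$ is a basis of the left eigenspace of $P(\lambda)$ at $\infty$.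
   Context: Notation: $\{0:m\}=\{0,1,\dots,m\}$, $-\{0:m\}=\{-m,\dots,-1,-0\}$, where $-0$ is a formal index different from $0$ (the successor of $-1$). $e_j$ is the $j$-th column of $I_m$; $\otimes$ is the Kronecker product. A matrix is called a basis of a subspace if its columns form one. Index tuples: an index tuple is a finite, possibly empty, tuple of indices. $(\alpha,\beta)$ denotes concatenation and $-\alpha$ negates all entries. A subtuple is obtained by deleting some entries. A tuple $(i_1,\dots,i_t)$ satisfies the Successor Infix Property (SIP) if whenever $a<b$ and $i_a=i_b$ there is $c$ with $a<c<b$ and $i_c=i_a+1$ (for tuples from $-\{0:m\}$ this is understood after shifting by $m$, so $-0$ is the successor of $-1$). For $t\in\alpha$, $c_t(\alpha)=p$ (consecutions at $t$) if $(t,t+1,\dots,t+p)$ is a subtuple of $\alpha$ but $(t,\dots,t+p+1)$ is not; $i_t(\alpha)=q$ (inversions at $t$) if $(t+q,\dots,t+1,t)$ is a subtuple of $\alpha$ but $(t+q+1,t+q,\dots,t)$ is not. If $t\notin\alpha$, $c_t(\alpha)=i_t(\alpha)=-1$. For example $c_{-m}(\tau)$ counts along $-m,-(m-1),\dots,-1,-0$. Elementary matrices (of size $mn\times mn$): for $X\in\mathbb{C}^{n\times n}$, $M_0(X)=\mathrm{diag}(I_{(m-1)n},X)$, $M_{-m}(X)=\mathrm{diag}(X,I_{(m-1)n})$, and for $i=1,\dots,m-1$ $$M_i(X)=\mathrm{diag}\Big(I_{(m-i-1)n},\begin{bmatrix}X & I_n \\ I_n & 0\end{bmatrix},I_{(i-1)n}\Big),\quad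 M_{-i}(X)=\mathrm{diag}\Big(I_{(m-i-1)n},\begin{bmatrix}0 & I_n \\ I_n & X\end{bmatrix},I_{(i-1)n}\Big).$$ $M_i^P=M_i(-A_i)$ for $0\le i\le m-1$, $M_{-i}^P=M_{-i}(A_i)$ for $1\le i\le m$, $M_{-0}^P=(M_0^P)^{-1}$, $M_m^P=(M_{-m}^P)^{-1}$ (the last two are used only when $A_0$, respectively $A_m$, is invertible; since $\infty$ is an eigenvalue here, $A_m$ is singular, so necessarily $-m\in\tau$). For a tuple $\mathbf t=(t_1,\dots,t_r)$, $M_{\mathbf t}^P=M_{t_1}^P\cdots M_{t_r}^P$; a matrix assignment for $\mathbf t$ is a tuple $X=(X_1,\dots,X_r)$ of $n\times n$ complex matrices, and $M_{\mathbf t}(X)=M_{t_1}(X_1)\cdots M_{t_r}(X_r)$. Empty products equal $I_{mn}$. An assignment is nonsingular if the matrices assigned to positions occupied by indices $\pm0,\pm m$ are nonsingular. EGFP: let $(\sigma,\omega)$ be a permutation of $\{0:m\}$ and $\tau=-\omega$. Let $\sigma_1,\sigma_2$ be index tuples with indices from $\sigma\setminus\{m-1,m\}$ such that $(\sigma_1,\sigma,\sigma_2)$ satisfies the SIP, and $\tau_1,\tau_2$ index tuples with indices from $\tau\setminus\{-1,-0\}$ such that $(\tau_1,\tau,\tau_2)$ satisfies the SIP. Let $X_1,X_2,Y_1,Y_2$ be arbitrary nonsingular matrix assignments for $\sigma_1,\sigma_2,\tau_1,\tau_2$. Then $M_{\tau_1}(Y_1)M_{\sigma_1}(X_1)(\lambda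 M^P_\tau-M^P_\sigma)M_{\sigma_2}(X_2)M_{\tau_2}(Y_2)$ is an EGFP of $P(\lambda)$. Eigenvalue at infinity: $P$ is regular if $\det P\not\equiv0$. $\infty$ is an eigenvalue of $P(\lambda)$ if $0$ is an eigenvalue of $\mathrm{rev}P(\lambda)=\sum_{i=0}^m\lambda^iA_{m-i}$, i.e. $A_m$ is singular; the right (left) eigenspace of $P$ at $\infty$ is $\{x:A_mx=0\}$ ($\{x:x^TA_m=0\}$). For a pencil $L(\lambda)=\lambda L_1-L_0$ the right (left) eigenspace at $\infty$ is $\{x:L_1x=0\}$ ($\{x:x^TL_1=0\}$). *)

theory Defs
  imports
    "HOL-Library.Sublist"
    "Jordan_Normal_Form.Matrix_Kernel"
    "Jordan_Normal_Form.DL_Rank"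
begin

section \<open>Index tuples\<close>

text \<open>\<open>NonNeg i\<close> is the index \<open>i\<close> and \<open>NonPos i\<close> is the index \<open>-i\<close>; in particular
  \<open>NonPos 0\<close> is the formal index \<open>-0\<close>, distinct from \<open>0\<close>.\<close>

datatype tuple_index = NonNeg nat | NonPos nat

fun neg_index :: "tuple_index \<Rightarrow> tuple_index" where
  "neg_index (NonNeg i) = NonPos i"
| "neg_index (NonPos i) = NonNeg i"

text \<open>\<open>is_succ s t\<close> means \<open>t = s + 1\<close>. The successor of \<open>-1\<close> is \<open>-0\<close>, and \<open>-0\<close>, the last
  element of \<open>-{0:m}\<close>, has no successor. For tuples with entries in \<open>-{0:m}\<close> this is the order
  obtained by adding \<open>m\<close> to all entries.\<close>

fun is_succ :: "tuple_index \<Rightarrow> tuple_index \<Rightarrow> bool" where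
  "is_succ (NonNeg i) t \<longleftrightarrow> t = NonNeg (Suc i)"
| "is_succ (NonPos (Suc i)) t \<longleftrightarrow> t = NonPos i"
| "is_succ (NonPos 0) t \<longleftrightarrow> False"

definition SIP :: "tuple_index list \<Rightarrow> bool" where
  "SIP \<alpha> \<longleftrightarrow> (\<forall>a b. a < b \<and> b < length \<alpha> \<and> \<alpha> ! a = \<alpha> ! b \<longrightarrow>
     (\<exists>c. a < c \<and> c < b \<and> is_succ (\<alpha> ! a) (\<alpha> ! c)))"

text \<open>\<open>is_run t p us\<close> means \<open>us = (t, t+1, \<dots>, t+p)\<close>; no such \<open>us\<close> exists when the successors
  run out, i.e. for \<open>t = -i\<close> and \<open>p > i\<close>.\<close>

definition is_run :: "tuple_index \<Rightarrow> nat \<Rightarrow> tuple_index list \<Rightarrow> bool" where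
  "is_run t p us \<longleftrightarrow> length us = Suc p \<and> hd us = t \<and> successively is_succ us"

definition consecutions :: "tuple_index \<Rightarrow> tuple_index list \<Rightarrow> int" where
  "consecutions t \<alpha> =
     (if t \<in> set \<alpha>
      then int (THE p. (\<exists>us. is_run t p us \<and> subseq us \<alpha>) \<and>
                       \<not> (\<exists>us. is_run t (Suc p) us \<and> subseq us \<alpha>))
      else -1)"

definition inversions :: "tuple_index \<Rightarrow> tuple_index list \<Rightarrow> int" where
  "inversions t \<alpha> =
     (if t \<in> set \<alpha>
      then int (THE q. (\<exists>us. is_run t q us \<and> subseq (rev us) \<alpha>) \<and>
                       \<not> (\<exists>us. is_run t (Suc q) us \<and> subseq (rev us) \<alpha>))
      else -1)"


section \<open>Elementary matrices\<close>

text \<open>The matrices \<open>M\<^sub>i(X)\<close>. They are not defined for the indices \<open>-0\<close> and \<open>m\<close>; only the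
  matrices \<open>M\<^sup>P\<close> below exist for these.\<close>

fun elem_mat :: "nat \<Rightarrow> nat \<Rightarrow> tuple_index \<Rightarrow> complex mat \<Rightarrow> complex mat" where
  "elem_mat m n (NonNeg i) X =
     (if i = 0 then diag_block_mat [1\<^sub>m ((m - 1) * n), X]
      else if i < m then
        diag_block_mat [1\<^sub>m ((m - i - 1) * n),
          four_block_mat X (1\<^sub>m n) (1\<^sub>m n) (0\<^sub>m n n),
          1\<^sub>m ((i - 1) * n)]
      else undefined)"
| "elem_mat m n (NonPos i) X =
     (if i = m then diag_block_mat [X, 1\<^sub>m ((m - 1) * n)]
      else if 0 < i \<and> i < m then
        diag_block_mat [1\<^sub>m ((m - i - 1) * n),
          four_block_mat (0\<^sub>m n n) (1\<^sub>m n) (1\<^sub>m n) X,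
          1\<^sub>m ((i - 1) * n)]
      else undefined)"

definition mat_inv :: "complex mat \<Rightarrow> complex mat" where
  "mat_inv B = the (mat_inverse B)"

text \<open>The matrices \<open>M\<^sub>i\<^sup>P\<close> for the matrix polynomial with coefficients \<open>A 0, \<dots>, A m\<close>.\<close>

fun elem_mat_P :: "nat \<Rightarrow> nat \<Rightarrow> (nat \<Rightarrow> complex mat) \<Rightarrow> tuple_index \<Rightarrow> complex mat" where
  "elem_mat_P m n A (NonNeg i) =
     (if i = m then mat_inv (elem_mat m n (NonPos m) (A m))
      else elem_mat m n (NonNeg i) (- A i))"
| "elem_mat_P m n A (NonPos i) =
     (if i = 0 then mat_inv (elem_mat m n (NonNeg 0) (- A 0))
      else elem_mat m n (NonPos i) (A i))"

definition tuple_mat_P ::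
    "nat \<Rightarrow> nat \<Rightarrow> (nat \<Rightarrow> complex mat) \<Rightarrow> tuple_index list \<Rightarrow> complex mat" where
  "tuple_mat_P m n A t = foldr (*) (map (elem_mat_P m n A) t) (1\<^sub>m (m * n))"

definition tuple_mat :: "nat \<Rightarrow> nat \<Rightarrow> tuple_index list \<Rightarrow> complex mat list \<Rightarrow> complex mat" where
  "tuple_mat m n t X = foldr (*) (map2 (elem_mat m n) t X) (1\<^sub>m (m * n))"

definition matrix_assignment :: "nat \<Rightarrow> tuple_index list \<Rightarrow> complex mat list \<Rightarrow> bool" where
  "matrix_assignment n t X \<longleftrightarrow> length X = length t \<and> set X \<subseteq> carrier_mat n n"

definition nonsingular_assignment ::
    "nat \<Rightarrow> nat \<Rightarrow> tuple_index list \<Rightarrow> complex mat list \<Rightarrow> bool" where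
  "nonsingular_assignment m n t X \<longleftrightarrow> matrix_assignment n t X \<and>
     (\<forall>j < length t. t ! j \<in> {NonNeg 0, NonPos 0, NonNeg m, NonPos m} \<longrightarrow>
        invertible_mat (X ! j))"


section \<open>Matrix polynomials\<close>

text \<open>A matrix polynomial is a matrix with entries in \<open>\<complex>[\<lambda>]\<close>, considered with an explicit
  grade: \<open>m\<close> for \<open>P(\<lambda>)\<close> and \<open>1\<close> for a pencil.\<close>

definition mat_poly :: "nat \<Rightarrow> nat \<Rightarrow> (nat \<Rightarrow> complex mat) \<Rightarrow> complex poly mat" where
  "mat_poly m n A = mat n n (\<lambda>(r, s). \<Sum>i\<le>m. monom (A i $$ (r, s)) i)"

definition const_mat :: "complex mat \<Rightarrow> complex poly mat" where
  "const_mat B = map_mat (\<lambda>c. [:c:]) B"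

definition coeff_mat :: "complex poly mat \<Rightarrow> nat \<Rightarrow> complex mat" where
  "coeff_mat Q i = map_mat (\<lambda>p. coeff p i) Q"

definition regular_mat_poly :: "complex poly mat \<Rightarrow> bool" where
  "regular_mat_poly Q \<longleftrightarrow> square_mat Q \<and> det Q \<noteq> 0"

definition mat_poly_eigenvalue :: "complex poly mat \<Rightarrow> complex \<Rightarrow> bool" where
  "mat_poly_eigenvalue Q z \<longleftrightarrow> det (map_mat (\<lambda>p. poly p z) Q) = 0"

definition rev_mat_poly :: "nat \<Rightarrow> complex poly mat \<Rightarrow> complex poly mat" where
  "rev_mat_poly g Q = map_mat (\<lambda>p. \<Sum>i\<le>g. monom (coeff p (g - i)) i) Q"

definition infinite_eigenvalue :: "nat \<Rightarrow> complex poly mat \<Rightarrow> bool" where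
  "infinite_eigenvalue g Q \<longleftrightarrow> mat_poly_eigenvalue (rev_mat_poly g Q) 0"

definition right_eigenspace_inf :: "nat \<Rightarrow> complex poly mat \<Rightarrow> complex vec set" where
  "right_eigenspace_inf g Q = mat_kernel (coeff_mat Q g)"

definition left_eigenspace_inf :: "nat \<Rightarrow> complex poly mat \<Rightarrow> complex vec set" where
  "left_eigenspace_inf g Q =
     {x \<in> carrier_vec (dim_row Q). mat_of_row x * coeff_mat Q g = 0\<^sub>m 1 (dim_col Q)}"

text \<open>\<open>Z\<close> is a basis of the subspace \<open>W\<close> of \<open>\<complex>\<^sup>N\<close>: its columns, as a family, form one.\<close>

definition basis_mat :: "nat \<Rightarrow> complex mat \<Rightarrow> complex vec set \<Rightarrow> bool" where
  "basis_mat N Z W \<longleftrightarrow> dim_row Z = N \<and> distinct (cols Z) \<and>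
     vectorspace.basis class_ring ((module_vec TYPE(complex) N)\<lparr>carrier := W\<rparr>) (set (cols Z))"

definition kronecker :: "complex mat \<Rightarrow> complex mat \<Rightarrow> complex mat" where
  "kronecker B C = mat (dim_row B * dim_row C) (dim_col B * dim_col C)
     (\<lambda>(i, j). B $$ (i div dim_row C, j div dim_col C) * C $$ (i mod dim_row C, j mod dim_col C))"

text \<open>\<open>e\<^sub>j\<^sup>T \<otimes> I\<^sub>n\<close>, where \<open>e\<^sub>j\<close> is the \<open>j\<close>-th column of \<open>I\<^sub>m\<close>, counted from \<open>1\<close>.\<close>

definition block_row :: "nat \<Rightarrow> nat \<Rightarrow> nat \<Rightarrow> complex mat" where
  "block_row m n j = kronecker (mat_of_row (unit_vec m (j - 1))) (1\<^sub>m n)"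


section \<open>Extended generalized Fiedler pencils\<close>

text \<open>The two invertibility conditions are the ones under which \<open>M\<^sub>-\<^sub>0\<^sup>P\<close> and \<open>M\<^sub>m\<^sup>P\<close>, which are
  defined as inverses, may be used.\<close>

definition EGFP_data ::
    "nat \<Rightarrow> nat \<Rightarrow> (nat \<Rightarrow> complex mat) \<Rightarrow> tuple_index list \<Rightarrow> tuple_index list \<Rightarrow>
     tuple_index list \<Rightarrow> tuple_index list \<Rightarrow> tuple_index list \<Rightarrow> tuple_index list \<Rightarrow>
     complex mat list \<Rightarrow> complex mat list \<Rightarrow> complex mat list \<Rightarrow> complex mat list \<Rightarrow> bool" where
  "EGFP_data m n A \<sigma> \<tau> \<sigma>\<^sub>1 \<sigma>\<^sub>2 \<tau>\<^sub>1 \<tau>\<^sub>2 X\<^sub>1 X\<^sub>2 Y\<^sub>1 Y\<^sub>2 \<longleftrightarrow>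
     (\<exists>\<omega>. \<tau> = map neg_index \<omega> \<and> distinct (\<sigma> @ \<omega>) \<and> set (\<sigma> @ \<omega>) = NonNeg ` {0..m}) \<and>
     (NonPos 0 \<in> set \<tau> \<longrightarrow> invertible_mat (A 0)) \<and>
     (NonNeg m \<in> set \<sigma> \<longrightarrow> invertible_mat (A m)) \<and>
     set \<sigma>\<^sub>1 \<union> set \<sigma>\<^sub>2 \<subseteq> set \<sigma> - {NonNeg (m - 1), NonNeg m} \<and>
     SIP (\<sigma>\<^sub>1 @ \<sigma> @ \<sigma>\<^sub>2) \<and>
     set \<tau>\<^sub>1 \<union> set \<tau>\<^sub>2 \<subseteq> set \<tau> - {NonPos 1, NonPos 0} \<and>
     SIP (\<tau>\<^sub>1 @ \<tau> @ \<tau>\<^sub>2) \<and>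
     nonsingular_assignment m n \<sigma>\<^sub>1 X\<^sub>1 \<and> nonsingular_assignment m n \<sigma>\<^sub>2 X\<^sub>2 \<and>
     nonsingular_assignment m n \<tau>\<^sub>1 Y\<^sub>1 \<and> nonsingular_assignment m n \<tau>\<^sub>2 Y\<^sub>2"

definition EGFP ::
    "nat \<Rightarrow> nat \<Rightarrow> (nat \<Rightarrow> complex mat) \<Rightarrow> tuple_index list \<Rightarrow> tuple_index list \<Rightarrow>
     tuple_index list \<Rightarrow> tuple_index list \<Rightarrow> tuple_index list \<Rightarrow> tuple_index list \<Rightarrow>
     complex mat list \<Rightarrow> complex mat list \<Rightarrow> complex mat list \<Rightarrow> complex mat list \<Rightarrow>
     complex poly mat" where
  "EGFP m n A \<sigma> \<tau> \<sigma>\<^sub>1 \<sigma>\<^sub>2 \<tau>\<^sub>1 \<tau>\<^sub>2 X\<^sub>1 X\<^sub>2 Y\<^sub>1 Y\<^sub>2 =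
     const_mat (tuple_mat m n \<tau>\<^sub>1 Y\<^sub>1) * const_mat (tuple_mat m n \<sigma>\<^sub>1 X\<^sub>1) *
     ([:0, 1:] \<cdot>\<^sub>m const_mat (tuple_mat_P m n A \<tau>) - const_mat (tuple_mat_P m n A \<sigma>)) *
     const_mat (tuple_mat m n \<sigma>\<^sub>2 X\<^sub>2) * const_mat (tuple_mat m n \<tau>\<^sub>2 Y\<^sub>2)"

end

theory Submission
  imports Defs
begin

text \<open>
  Write \<open>L(\<lambda>) = \<lambda> L\<^sub>1 - L\<^sub>0\<close>. As \<open>A\<^sub>m\<close> is singular, \<open>-m\<close> belongs to \<open>\<tau>\<close>, say \<open>\<tau> = (a, -m, b)\<close>. All
  other factors of \<open>L\<^sub>1\<close> are invertible, so \<open>L\<^sub>1 = U diag(A\<^sub>m, I) W\<close> with \<open>U\<close> and \<open>W\<close> invertible, where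
  \<open>W\<close> is the product of the factors to the right of \<open>M\<^sub>-\<^sub>m\<^sup>P\<close>: those of \<open>b\<close>, then those of \<open>\<sigma>\<^sub>2\<close>
  and \<open>\<tau>\<^sub>2\<close>. A vector \<open>z\<close> lies in the kernel of \<open>L\<^sub>1\<close> if and only if
  \<open>W z = (x, 0)\<close> with \<open>A\<^sub>m x = 0\<close>; hence \<open>z \<mapsto> (e\<^sub>1\<^sup>T \<otimes> I) W z\<close> is an isomorphism from the right eigenspace of
  \<open>L\<close> to that of \<open>P\<close> (\<open>bij_betw_kernels\<close>), and it takes bases to bases (\<open>basis_mat_image\<close>). It remains
  to compute the block row \<open>(e\<^sub>1\<^sup>T \<otimes> I) W\<close>.

  To this end the row is followed through the factors of \<open>W\<close> from left to right. The index \<open>-(m-s)\<close>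
  takes the block row \<open>e\<^sub>s\<^sup>T \<otimes> I\<close> to \<open>e\<^sub>s\<^sub>+\<^sub>1\<^sup>T \<otimes> I\<close>, whatever matrix is assigned to it, and every other index
  fixes the row, except for \<open>-(m-s+1)\<close>, \<open>m-s\<close> and \<open>m-s+1\<close> (\<open>block_row_elem_mat\<close>). These exceptions are
  excluded by the Successor Infix Property (\<open>not_blocking_\<tau>\<close>, \<open>not_blocking_\<sigma>\<close>). So the row advances exactly
  when the next member of the run \<open>-m, -(m-1), \<dots>\<close> is met; this is a greedy search for the longest such
  run in \<open>(\<tau>, \<tau>\<^sub>2)\<close>, and it ends in the row of number \<open>c\<^sub>-\<^sub>m(\<tau>, \<tau>\<^sub>2) + 1\<close> (\<open>consecutions_eq_foldl\<close>). The only
  deviation occurs when the run is completed by \<open>-0\<close>: the factor \<open>M\<^sub>-\<^sub>0\<^sup>P\<close> leaves the last row in place and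
  multiplies it by \<open>(-A\<^sub>0)\<^sup>-\<^sup>1\<close>, whose sign does not matter for a basis.

  Left eigenvectors of \<open>L\<close> are right eigenvectors of \<open>L\<^sup>T\<close>. Transposition reverses the tuples and transposes
  the coefficients and assigned matrices, since the elementary matrices satisfy
  \<open>M\<^sub>i(X)\<^sup>T = M\<^sub>i(X\<^sup>T)\<close>; the reversed tuples still have the Successor Infix Property, and consecutions become
  inversions. So the left half is the right half for the transposed data.
\<close>

section \<open>Images of bases\<close>

text \<open>A linear isomorphism takes a basis to a basis. As the columns of \<open>Z\<close> are distinct and the map is
  injective on them, the columns of \<open>F Z\<close> are distinct as well.\<close>

lemma basis_mat_image:
  assumes D: "D \<in> carrier_mat r N" and C: "C \<in> carrier_mat s d" and F: "F \<in> carrier_mat d N"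
    and bij: "bij_betw (\<lambda>v. F *\<^sub>v v) (mat_kernel D) (mat_kernel C)"
    and Z: "basis_mat N Z (mat_kernel D)"
  shows "basis_mat d (F * Z) (mat_kernel C)"
proof -
  interpret KD: kernel r N D by unfold_locales (rule D)
  interpret KC: kernel s d C by unfold_locales (rule C)
  let ?V = "(module_vec TYPE(complex) N)\<lparr>carrier := mat_kernel D\<rparr>"
  let ?W = "(module_vec TYPE(complex) d)\<lparr>carrier := mat_kernel C\<rparr>"
  have dimZ: "dim_row Z = N" and dist: "distinct (cols Z)"
    and basis: "KD.Ker.basis (set (cols Z))"
    using Z unfolding basis_mat_def by auto
  have colsZ: "set (cols Z) \<subseteq> mat_kernel D"
    using basis unfolding KD.Ker.basis_def by simp
  have kerD: "mat_kernel D \<subseteq> carrier_vec N" by (rule mat_kernel_carrier[OF D])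
  have vsV: "vectorspace class_ring ?V" by (rule KD.Ker.vectorspace_axioms)
  have vsW: "vectorspace class_ring ?W" by (rule KC.Ker.vectorspace_axioms)
  have hom: "(\<lambda>v. F *\<^sub>v v) \<in> LinearCombinations.module_hom class_ring ?V ?W"
    using bij F kerD
    by (auto simp: LinearCombinations.module_hom_def bij_betw_def module_vec_simps class_ring_simps
          mult_add_distrib_mat_vec[OF F] mult_mat_vec[OF F] subset_iff)
  have lin: "linear_map class_ring ?V ?W (\<lambda>v. F *\<^sub>v v)"
    using vsV vsW hom
    by (intro linear_map.intro mod_hom.intro mod_hom_axioms.intro)
      (auto simp: vectorspace_def)
  interpret T: linear_map class_ring ?V ?W "\<lambda>v. F *\<^sub>v v" by (rule lin)
  have fin: "KD.Ker.fin_dim"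
    using basis by (auto simp: KD.Ker.fin_dim_def KD.Ker.basis_def intro!: exI[of _ "set (cols Z)"])
  have im: "KC.Ker.basis ((\<lambda>v. F *\<^sub>v v) ` set (cols Z))"
    using T.linear_inj_image_is_basis[of "set (cols Z)"] bij basis fin
    by (auto simp: bij_betw_def)
  have cols: "cols (F * Z) = map (\<lambda>v. F *\<^sub>v v) (cols Z)"
    using F dimZ by (intro nth_equalityI) (auto simp: col_mult2[of F d N Z "dim_col Z"])
  have "distinct (cols (F * Z))"
    using dist colsZ bij unfolding cols
    by (auto simp: distinct_map bij_betw_def intro: inj_on_subset)
  moreover have "dim_row (F * Z) = d" using F by simp
  ultimately show ?thesis
    unfolding basis_mat_def using im by (simp add: cols)
qed

section \<open>The elementary matrices\<close>

abbreviation pad_diag :: "nat \<Rightarrow> complex mat \<Rightarrow> nat \<Rightarrow> complex mat" where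
  "pad_diag a F b \<equiv> diag_block_mat [1\<^sub>m a, F, 1\<^sub>m b]"

lemma pad_diag_carrier:
  "F \<in> carrier_mat k k \<Longrightarrow> pad_diag a F b \<in> carrier_mat (a + k + b) (a + k + b)"
  by (intro carrier_matI) (auto simp: dim_diag_block_mat)

lemma pad_diag_index:
  assumes "F \<in> carrier_mat k k" "r < a + k + b" "c < a + k + b"
  shows "pad_diag a F b $$ (r, c) =
    (if a \<le> r \<and> r < a + k \<and> a \<le> c \<and> c < a + k then F $$ (r - a, c - a)
     else if r = c then 1 else 0)"
  using assms by (auto simp: Let_def)

lemma pad_diag_mult:
  assumes F: "F \<in> carrier_mat k k" and G: "G \<in> carrier_mat k k"
  shows "pad_diag a F b * pad_diag a G b = pad_diag a (F * G) b"
proof -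
  have 1: "diag_block_mat [F, 1\<^sub>m b] * diag_block_mat [G, 1\<^sub>m b] = diag_block_mat [F * G, 1\<^sub>m b]"
    using F G
    by (simp add: diag_block_mat.simps(2)[of _ "[1\<^sub>m b]"] Let_def del: diag_block_mat.simps)
      (simp add: mult_four_block_mat[OF F zero_carrier_mat zero_carrier_mat one_carrier_mat
          G zero_carrier_mat zero_carrier_mat one_carrier_mat])
  have 2: "diag_block_mat [H, 1\<^sub>m b] \<in> carrier_mat (k + b) (k + b)" if "H \<in> carrier_mat k k" for H :: "complex mat"
    using that by (intro carrier_matI) (auto simp: dim_diag_block_mat)
  have 3: "pad_diag a H b = four_block_mat (1\<^sub>m a) (0\<^sub>m a (k + b)) (0\<^sub>m (k + b) a) (diag_block_mat [H, 1\<^sub>m b])"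
    if "H \<in> carrier_mat k k" for H
    using 2[OF that] that by (simp only: diag_block_mat.simps(2)[of "1\<^sub>m a"] Let_def) auto
  show ?thesis
    unfolding 3[OF F] 3[OF G] 3[OF mult_carrier_mat[OF F G]]
    by (subst mult_four_block_mat[OF _ _ _ 2[OF F] _ _ _ 2[OF G]])
      (use 1 2[OF mult_carrier_mat[OF F G]] 2[OF F] 2[OF G] in
        \<open>auto simp del: diag_block_mat.simps\<close>)
qed

lemma pad_diag_one: "pad_diag a (1\<^sub>m k) b = 1\<^sub>m (a + k + b)"
  using diag_block_one_mat[of "[1\<^sub>m a, 1\<^sub>m k, 1\<^sub>m b :: complex mat]"] by (simp add: add.assoc)

lemma pad_diag_transpose:
  assumes F: "F \<in> carrier_mat k k"
  shows "(pad_diag a F b)\<^sup>T = pad_diag a F\<^sup>T b"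
proof (rule eq_matI)
  have FT: "F\<^sup>T \<in> carrier_mat k k" using F by simp
  note c = pad_diag_carrier[OF F, of a b] pad_diag_carrier[OF FT, of a b]
  show "dim_row (pad_diag a F b)\<^sup>T = dim_row (pad_diag a F\<^sup>T b)"
    "dim_col (pad_diag a F b)\<^sup>T = dim_col (pad_diag a F\<^sup>T b)"
    using c by auto
  fix i j assume "i < dim_row (pad_diag a F\<^sup>T b)" "j < dim_col (pad_diag a F\<^sup>T b)"
  then have ij: "i < a + k + b" "j < a + k + b" using c by auto
  have "(pad_diag a F b)\<^sup>T $$ (i, j) = pad_diag a F b $$ (j, i)"
    using ij c by (intro index_transpose_mat) auto
  also have "\<dots> = pad_diag a F\<^sup>T b $$ (i, j)"
    using ij F unfolding pad_diag_index[OF F ij(2,1)] pad_diag_index[OF FT ij] by auto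
  finally show "(pad_diag a F b)\<^sup>T $$ (i, j) = pad_diag a F\<^sup>T b $$ (i, j)" .
qed

text \<open>Invertibility is handled through nonzero determinants, since these behave well under products and
  transposition.\<close>

lemma det_nonzero_if_inverse:
  fixes F :: "complex mat"
  assumes "F \<in> carrier_mat k k" "G \<in> carrier_mat k k" "F * G = 1\<^sub>m k"
  shows "det F \<noteq> 0"
proof
  assume "det F = 0"
  moreover have "det F * det G = 1" using det_mult[OF assms(1,2)] assms(3) by simp
  ultimately show False by simp
qed

lemma inverse_if_det_nonzero:
  fixes F :: "complex mat"
  assumes F: "F \<in> carrier_mat k k" and "det F \<noteq> 0"
  obtains G where "G \<in> carrier_mat k k" "F * G = 1\<^sub>m k" "G * F = 1\<^sub>m k"
proof -
  have "F \<in> Units (ring_mat TYPE(complex) k ())" using det_non_zero_imp_unit[OF F] assms(2) by simp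
  then show ?thesis using that F by (auto simp: Units_def ring_mat_simps)
qed

lemma det_nonzero_if_invertible_mat:
  fixes X :: "complex mat"
  assumes X: "X \<in> carrier_mat n n" and "invertible_mat X"
  shows "det X \<noteq> 0"
proof -
  obtain B where B: "X * B = 1\<^sub>m n" "B * X = 1\<^sub>m (dim_row B)"
    using assms by (auto simp: invertible_mat_def inverts_mat_def)
  have "dim_col B = n" using arg_cong[OF B(1), of dim_col] by simp
  moreover have "dim_row B = n" using arg_cong[OF B(2), of dim_col] X by simp
  ultimately show ?thesis using det_nonzero_if_inverse[OF X _ B(1)] by auto
qed

lemma invertible_mat_if_det_nonzero:
  fixes X :: "complex mat"
  assumes X: "X \<in> carrier_mat n n" and "det X \<noteq> 0"
  shows "invertible_mat X"
  using inverse_if_det_nonzero[OF assms] X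
  by (metis carrier_matD invertible_mat_def inverts_mat_def square_mat.elims(3))

lemma mat_inv_inverse:
  assumes X: "X \<in> carrier_mat n n" and d: "det X \<noteq> 0"
  shows "mat_inv X \<in> carrier_mat n n" "X * mat_inv X = 1\<^sub>m n" "mat_inv X * X = 1\<^sub>m n"
proof -
  have "mat_inverse X \<noteq> None"
    using mat_inverse(1)[OF X, of "()"] det_non_zero_imp_unit[OF X d, of "()"] by auto
  then obtain B where B: "mat_inverse X = Some B" by blast
  show "mat_inv X \<in> carrier_mat n n" "X * mat_inv X = 1\<^sub>m n" "mat_inv X * X = 1\<^sub>m n"
    using mat_inverse(2)[OF X B] by (auto simp: mat_inv_def B)
qed

lemma det_transpose_nonzero:
  "X \<in> carrier_mat n n \<Longrightarrow> det (X :: complex mat) \<noteq> 0 \<Longrightarrow> det X\<^sup>T \<noteq> 0"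
  by (simp add: det_transpose)

text \<open>\<open>(X\<^sup>-\<^sup>1)\<^sup>T\<close> is a left inverse of \<open>X\<^sup>T\<close>, and inverses are unique.\<close>

lemma mat_inv_transpose:
  assumes X: "X \<in> carrier_mat n n" and d: "det X \<noteq> 0"
  shows "mat_inv X\<^sup>T = (mat_inv X)\<^sup>T"
proof -
  have XT: "X\<^sup>T \<in> carrier_mat n n" using X by simp
  note i = mat_inv_inverse[OF X d] and iT = mat_inv_inverse[OF XT det_transpose_nonzero[OF X d]]
  have 1: "(mat_inv X)\<^sup>T * X\<^sup>T = 1\<^sub>m n"
    using transpose_mult[OF X i(1)] i(2) by simp
  have "mat_inv X\<^sup>T = (mat_inv X)\<^sup>T * X\<^sup>T * mat_inv X\<^sup>T" using 1 iT by simp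
  also have "\<dots> = (mat_inv X)\<^sup>T * (X\<^sup>T * mat_inv X\<^sup>T)"
    using i(1) iT(1) XT by (intro assoc_mult_mat) auto
  also have "\<dots> = (mat_inv X)\<^sup>T" using iT(2) i(1) by simp
  finally show ?thesis .
qed

text \<open>The indices for which \<open>M\<^sub>i(X)\<close> exists for every \<open>X\<close>; \<open>-0\<close> and \<open>m\<close> occur only in
  \<open>M\<^sup>P\<close>, through inverses.\<close>

fun elem_index :: "nat \<Rightarrow> tuple_index \<Rightarrow> bool" where
  "elem_index m (NonNeg i) \<longleftrightarrow> i < m"
| "elem_index m (NonPos i) \<longleftrightarrow> 0 < i \<and> i \<le> m"

lemma elem_mat_pad_diag:
  assumes X: "X \<in> carrier_mat n n" and m: "m \<ge> 2"
  shows "elem_mat m n (NonNeg 0) X = pad_diag ((m - 1) * n) X 0"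
    and "elem_mat m n (NonPos m) X = pad_diag 0 X ((m - 1) * n)"
    and "0 < i \<Longrightarrow> i < m \<Longrightarrow> elem_mat m n (NonNeg i) X =
      pad_diag ((m - i - 1) * n) (four_block_mat X (1\<^sub>m n) (1\<^sub>m n) (0\<^sub>m n n)) ((i - 1) * n)"
    and "0 < i \<Longrightarrow> i < m \<Longrightarrow> elem_mat m n (NonPos i) X =
      pad_diag ((m - i - 1) * n) (four_block_mat (0\<^sub>m n n) (1\<^sub>m n) (1\<^sub>m n) X) ((i - 1) * n)"
  using X m by (auto simp: Let_def intro!: eq_matI)

lemma pad_sizes:
  assumes "m \<ge> (2::nat)"
  shows "(m - 1) * n + n + 0 = m * n" "0 + n + (m - 1) * n = m * n"
    and "0 < i \<Longrightarrow> i < m \<Longrightarrow> (m - i - 1) * n + (n + n) + (i - 1) * n = m * n"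
proof -
  obtain q where q: "m = Suc q" using assms by (cases m) auto
  show "(m - 1) * n + n + 0 = m * n" "0 + n + (m - 1) * n = m * n" by (auto simp: q)
  assume i: "0 < i" "i < m"
  then obtain j where "i = Suc j" by (cases i) auto
  moreover from this i obtain l where "m = Suc (Suc j) + l" using le_Suc_ex[of "Suc (Suc j)" m] by auto
  ultimately show "(m - i - 1) * n + (n + n) + (i - 1) * n = m * n" by (simp add: algebra_simps)
qed

lemma swap_blocks_carrier:
  assumes "X \<in> carrier_mat n n"
  shows "four_block_mat X (1\<^sub>m n) (1\<^sub>m n) (0\<^sub>m n n) \<in> carrier_mat (n + n) (n + n)"
    and "four_block_mat (0\<^sub>m n n) (1\<^sub>m n) (1\<^sub>m n) X \<in> carrier_mat (n + n) (n + n)"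
  using assms by auto

text \<open>The matrices \<open>M\<^sub>i(X)\<close> and \<open>M\<^sub>-\<^sub>i(-X)\<close> with \<open>0 < i < m\<close> are inverse to each other. This is
  why a matrix assignment has to be nonsingular only at the indices of absolute value \<open>0\<close> or \<open>m\<close>.\<close>

lemma swap_blocks_inverse:
  fixes X :: "complex mat"
  assumes X: "X \<in> carrier_mat n n"
  shows "four_block_mat X (1\<^sub>m n) (1\<^sub>m n) (0\<^sub>m n n) *
      four_block_mat (0\<^sub>m n n) (1\<^sub>m n) (1\<^sub>m n) (- X) = 1\<^sub>m (n + n)"
    and "four_block_mat (0\<^sub>m n n) (1\<^sub>m n) (1\<^sub>m n) X *
      four_block_mat (- X) (1\<^sub>m n) (1\<^sub>m n) (0\<^sub>m n n) = 1\<^sub>m (n + n)"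
proof -
  have X': "- X \<in> carrier_mat n n" and z: "X + - X = 0\<^sub>m n n" "- 0\<^sub>m n n = (0\<^sub>m n n :: complex mat)"
    using X by auto
  show "four_block_mat X (1\<^sub>m n) (1\<^sub>m n) (0\<^sub>m n n) *
      four_block_mat (0\<^sub>m n n) (1\<^sub>m n) (1\<^sub>m n) (- X) = 1\<^sub>m (n + n)"
    using X X' z
    by (simp add: mult_four_block_mat[OF X one_carrier_mat one_carrier_mat zero_carrier_mat
          zero_carrier_mat one_carrier_mat one_carrier_mat X'])
  show "four_block_mat (0\<^sub>m n n) (1\<^sub>m n) (1\<^sub>m n) X *
      four_block_mat (- X) (1\<^sub>m n) (1\<^sub>m n) (0\<^sub>m n n) = 1\<^sub>m (n + n)"
    using X X' z
    by (simp add: mult_four_block_mat[OF zero_carrier_mat one_carrier_mat one_carrier_mat X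
          X' one_carrier_mat one_carrier_mat zero_carrier_mat])
qed

lemma elem_index_cases:
  assumes "elem_index m t" "m \<ge> 2"
  obtains "t = NonNeg 0" | "t = NonPos m" | i where "0 < i" "i < m" "t = NonNeg i"
    | i where "0 < i" "i < m" "t = NonPos i"
  using assms by (cases t) (auto simp: le_less)

lemma elem_mat_carrier:
  assumes m: "m \<ge> 2" and t: "elem_index m t" and X: "X \<in> carrier_mat n n"
  shows "elem_mat m n t X \<in> carrier_mat (m * n) (m * n)"
  using t m
proof (cases rule: elem_index_cases)
  case 1
  show ?thesis unfolding 1 elem_mat_pad_diag(1)[OF X m]
    using pad_diag_carrier[OF X] pad_sizes(1)[OF m] by metis
next
  case 2
  show ?thesis unfolding 2 elem_mat_pad_diag(2)[OF X m]
    using pad_diag_carrier[OF X] pad_sizes(2)[OF m] by metis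
next
  case (3 i)
  show ?thesis unfolding 3(3) elem_mat_pad_diag(3)[OF X m 3(1,2)]
    using pad_diag_carrier[OF swap_blocks_carrier(1)[OF X]] pad_sizes(3)[OF m 3(1,2)] by metis
next
  case (4 i)
  show ?thesis unfolding 4(3) elem_mat_pad_diag(4)[OF X m 4(1,2)]
    using pad_diag_carrier[OF swap_blocks_carrier(2)[OF X]] pad_sizes(3)[OF m 4(1,2)] by metis
qed

lemma elem_mat_transpose:
  assumes m: "m \<ge> 2" and t: "elem_index m t" and X: "X \<in> carrier_mat n n"
  shows "(elem_mat m n t X)\<^sup>T = elem_mat m n t X\<^sup>T"
proof -
  have XT: "X\<^sup>T \<in> carrier_mat n n" using X by simp
  have sw: "(four_block_mat X (1\<^sub>m n) (1\<^sub>m n) (0\<^sub>m n n))\<^sup>T = four_block_mat X\<^sup>T (1\<^sub>m n) (1\<^sub>m n) (0\<^sub>m n n)"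
    "(four_block_mat (0\<^sub>m n n) (1\<^sub>m n) (1\<^sub>m n) X)\<^sup>T = four_block_mat (0\<^sub>m n n) (1\<^sub>m n) (1\<^sub>m n) X\<^sup>T"
    using transpose_four_block_mat[OF X one_carrier_mat one_carrier_mat zero_carrier_mat]
      transpose_four_block_mat[OF zero_carrier_mat one_carrier_mat one_carrier_mat X] by simp_all
  show ?thesis
    using t m
    by (cases rule: elem_index_cases)
      (simp_all only: elem_mat_pad_diag[OF X m] elem_mat_pad_diag[OF XT m]
        pad_diag_transpose[OF X] pad_diag_transpose[OF swap_blocks_carrier(1)[OF X]]
        pad_diag_transpose[OF swap_blocks_carrier(2)[OF X]] sw)
qed

lemma det_pad_diag_nonzero:
  assumes F: "F \<in> carrier_mat k k" and G: "G \<in> carrier_mat k k" and FG: "F * G = 1\<^sub>m k"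
  shows "det (pad_diag a F b) \<noteq> 0"
  using det_nonzero_if_inverse[OF pad_diag_carrier[OF F] pad_diag_carrier[OF G]]
    pad_diag_mult[OF F G] FG pad_diag_one by metis

lemma det_elem_mat_nonzero:
  assumes m: "m \<ge> 2" and t: "elem_index m t" and X: "X \<in> carrier_mat n n"
    and d: "t \<in> {NonNeg 0, NonPos m} \<Longrightarrow> det X \<noteq> 0"
  shows "det (elem_mat m n t X) \<noteq> 0"
  using t m
proof (cases rule: elem_index_cases)
  case 1
  then obtain G where "G \<in> carrier_mat n n" "X * G = 1\<^sub>m n"
    using inverse_if_det_nonzero[OF X] d by auto
  then show ?thesis unfolding 1 elem_mat_pad_diag(1)[OF X m]
    using det_pad_diag_nonzero[OF X] by blast
next
  case 2
  then obtain G where "G \<in> carrier_mat n n" "X * G = 1\<^sub>m n"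
    using inverse_if_det_nonzero[OF X] d by auto
  then show ?thesis unfolding 2 elem_mat_pad_diag(2)[OF X m]
    using det_pad_diag_nonzero[OF X] by blast
next
  case (3 i)
  have "- X \<in> carrier_mat n n" using X by simp
  then show ?thesis unfolding 3(3) elem_mat_pad_diag(3)[OF X m 3(1,2)]
    using det_pad_diag_nonzero swap_blocks_carrier X swap_blocks_inverse(1)[OF X] by blast
next
  case (4 i)
  have "- X \<in> carrier_mat n n" using X by simp
  then show ?thesis unfolding 4(3) elem_mat_pad_diag(4)[OF X m 4(1,2)]
    using det_pad_diag_nonzero swap_blocks_carrier X swap_blocks_inverse(2)[OF X] by blast
qed

section \<open>Block rows of the elementary matrices\<close>

lemma block_row_eq:
  assumes s: "1 \<le> s" "s \<le> m"
  shows "block_row m n s = mat n (m * n) (\<lambda>(r, c). if c = (s - 1) * n + r then 1 else 0)"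
proof (rule eq_matI)
  fix r c
  assume "r < dim_row (mat n (m * n) (\<lambda>(r, c). if c = (s - 1) * n + r then 1 else (0::complex)))"
    and "c < dim_col (mat n (m * n) (\<lambda>(r, c). if c = (s - 1) * n + r then 1 else (0::complex)))"
  then have r: "r < n" and c: "c < m * n" by auto
  then have n: "n > 0" by simp
  have d: "c div n < m" using c n by (simp add: less_mult_imp_div_less)
  have "c = (s - 1) * n + r \<longleftrightarrow> c div n = s - 1 \<and> c mod n = r"
    using r n by (metis div_mult_mod_eq div_mult_self3 div_less mod_mult_self3 mod_less add_0_right not_less0)
  then show "block_row m n s $$ (r, c) =
      mat n (m * n) (\<lambda>(r, c). if c = (s - 1) * n + r then 1 else 0) $$ (r, c)"
    using r c n d s by (auto simp: block_row_def kronecker_def mat_of_row_def)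
qed (auto simp: block_row_def kronecker_def mat_of_row_def)

lemma block_row_carrier: "block_row m n s \<in> carrier_mat n (m * n)"
  by (intro carrier_matI) (auto simp: block_row_def kronecker_def mat_of_row_def)

lemma block_row_bound:
  assumes "1 \<le> s" "s \<le> (m::nat)" "r < n"
  shows "(s - 1) * n + r < m * n"
proof -
  have "(s - 1) * n + r < (s - 1) * n + n" using assms by simp
  also have "\<dots> = s * n" using assms by (cases s) auto
  also have "\<dots> \<le> m * n" using assms by simp
  finally show ?thesis .
qed

text \<open>Multiplying by \<open>e\<^sub>s\<^sup>T \<otimes> I\<close> from the left cuts out the \<open>s\<close>-th block row, so that the lemmas below
  only have to read off the rows \<open>(s - 1) n, \<dots>, s n - 1\<close> of a matrix.\<close>

lemma block_row_mult:
  assumes s: "1 \<le> s" "s \<le> m" and E: "E \<in> carrier_mat (m * n) k"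
  shows "block_row m n s * E = mat n k (\<lambda>(r, c). E $$ ((s - 1) * n + r, c))"
proof (rule eq_matI)
  fix r c
  assume "r < dim_row (mat n k (\<lambda>(r, c). E $$ ((s - 1) * n + r, c)))"
    and "c < dim_col (mat n k (\<lambda>(r, c). E $$ ((s - 1) * n + r, c)))"
  then have r: "r < n" and c: "c < k" by auto
  have "(block_row m n s * E) $$ (r, c) =
      (\<Sum>l = 0..<m * n. (if l = (s - 1) * n + r then 1 else 0) * E $$ (l, c))"
    using r c E s by (simp add: block_row_eq scalar_prod_def)
  also have "\<dots> = (\<Sum>l = 0..<m * n. if l = (s - 1) * n + r then E $$ (l, c) else 0)"
    by (intro sum.cong) auto
  also have "\<dots> = E $$ ((s - 1) * n + r, c)"
    using block_row_bound[OF s r] by simp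
  finally show "(block_row m n s * E) $$ (r, c) =
      mat n k (\<lambda>(r, c). E $$ ((s - 1) * n + r, c)) $$ (r, c)"
    using r c by simp
qed (use E s in \<open>auto simp: block_row_eq\<close>)

lemma block_row_pad_diag_outside:
  assumes F: "F \<in> carrier_mat k k" and N: "a + k + b = m * n"
    and s: "1 \<le> s" "s \<le> m" and out: "s * n \<le> a \<or> a + k \<le> (s - 1) * n"
  shows "block_row m n s * pad_diag a F b = block_row m n s"
proof -
  have E: "pad_diag a F b \<in> carrier_mat (m * n) (m * n)"
    using pad_diag_carrier[OF F, of a b] N by simp
  have "pad_diag a F b $$ ((s - 1) * n + r, c) = (if c = (s - 1) * n + r then 1 else 0)"
    if r: "r < n" and c: "c < m * n" for r c
  proof -
    have "(s - 1) * n + r < s * n" using r s by (cases s) auto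
    then show ?thesis
      using pad_diag_index[OF F, of "(s - 1) * n + r" a b c] block_row_bound[OF s r] c out N by auto
  qed
  then show ?thesis
    unfolding block_row_mult[OF s E] by (subst block_row_eq[OF s]) (auto intro!: cong_mat)
qed

text \<open>The upper block row of \<open>M\<^sub>-\<^sub>i(X)\<close> is \<open>(0, I)\<close>, for every \<open>X\<close>: this is the only way in which a block
  row advances.\<close>

lemma block_row_pad_diag_swap:
  assumes X: "X \<in> carrier_mat n n" and N: "(s - 1) * n + (n + n) + b = m * n"
    and s: "1 \<le> s" "s < m"
  shows "block_row m n s * pad_diag ((s - 1) * n) (four_block_mat (0\<^sub>m n n) (1\<^sub>m n) (1\<^sub>m n) X) b =
    block_row m n (Suc s)"
proof -
  let ?F = "four_block_mat (0\<^sub>m n n) (1\<^sub>m n) (1\<^sub>m n) X"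
  have F: "?F \<in> carrier_mat (n + n) (n + n)" using X by simp
  have E: "pad_diag ((s - 1) * n) ?F b \<in> carrier_mat (m * n) (m * n)"
    using pad_diag_carrier[OF F, of "(s - 1) * n" b] N by simp
  have s': "s \<le> m" "1 \<le> Suc s" "Suc s \<le> m" using s by auto
  have sn: "s * n = (s - 1) * n + n" using s by (cases s) auto
  have "pad_diag ((s - 1) * n) ?F b $$ ((s - 1) * n + r, c) =
      (if c = (Suc s - 1) * n + r then 1 else 0)"
    if r: "r < n" and c: "c < m * n" for r c
  proof -
    have Fr: "?F $$ (r, q) = (if q = n + r then 1 else 0)" if "q < n + n" for q
      using r that X by auto
    have "pad_diag ((s - 1) * n) ?F b $$ ((s - 1) * n + r, c) =
        (if (s - 1) * n \<le> c \<and> c < (s - 1) * n + (n + n) then ?F $$ (r, c - (s - 1) * n)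
         else if (s - 1) * n + r = c then 1 else 0)"
      using pad_diag_index[OF F, of "(s - 1) * n + r" "(s - 1) * n" b c]
        block_row_bound[OF s(1) s'(1) r] r c N by simp
    also have "\<dots> = (if c = (s - 1) * n + (n + r) then 1 else 0)"
    proof (cases "(s - 1) * n \<le> c \<and> c < (s - 1) * n + (n + n)")
      case True
      then show ?thesis using Fr[of "c - (s - 1) * n"] by auto
    next
      case False
      then show ?thesis using r by auto
    qed
    finally show ?thesis using sn by (simp add: add.assoc)
  qed
  then show ?thesis
    unfolding block_row_mult[OF s(1) s'(1) E]
    by (subst block_row_eq[OF s'(2,3)]) (auto intro!: cong_mat)
qed

lemma block_row_last_pad_diag:
  assumes X: "X \<in> carrier_mat n n" and m: "m \<ge> 1"
  shows "block_row m n m * pad_diag ((m - 1) * n) X 0 = X * block_row m n m"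
proof -
  have N: "(m - 1) * n + n + 0 = m * n" using m by (cases m) auto
  have E: "pad_diag ((m - 1) * n) X 0 \<in> carrier_mat (m * n) (m * n)"
    using pad_diag_carrier[OF X, of "(m - 1) * n" 0] N by simp
  show ?thesis
  proof (rule eq_matI)
    fix r c
    assume "r < dim_row (X * block_row m n m)" "c < dim_col (X * block_row m n m)"
    then have r: "r < n" and c: "c < m * n" using X block_row_carrier[of m n m] by auto
    have "(block_row m n m * pad_diag ((m - 1) * n) X 0) $$ (r, c) =
        pad_diag ((m - 1) * n) X 0 $$ ((m - 1) * n + r, c)"
      using r c unfolding block_row_mult[OF m le_refl E] by simp
    also have "\<dots> = (if (m - 1) * n \<le> c then X $$ (r, c - (m - 1) * n) else 0)"
      using pad_diag_index[OF X, of "(m - 1) * n + r" "(m - 1) * n" 0 c] r c N by auto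
    also have "\<dots> = (\<Sum>l = 0..<n. X $$ (r, l) * (if c = (m - 1) * n + l then 1 else 0))"
    proof (cases "(m - 1) * n \<le> c")
      case True
      then obtain q where q: "c = (m - 1) * n + q" by (metis le_add_diff_inverse)
      have "q < n" using c N q by simp
      have "(\<Sum>l = 0..<n. X $$ (r, l) * (if c = (m - 1) * n + l then 1 else 0)) =
          (\<Sum>l = 0..<n. if l = q then X $$ (r, l) else 0)"
        by (intro sum.cong) (auto simp: q)
      also have "\<dots> = X $$ (r, q)" using \<open>q < n\<close> by simp
      finally show ?thesis by (simp add: q)
    next
      case False
      then show ?thesis by (auto intro!: sum.neutral[symmetric])
    qed
    also have "\<dots> = (X * block_row m n m) $$ (r, c)"
      using r c X by (simp add: block_row_eq[OF m le_refl] scalar_prod_def)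
    finally show "(block_row m n m * pad_diag ((m - 1) * n) X 0) $$ (r, c) =
        (X * block_row m n m) $$ (r, c)" .
  qed (use E X block_row_carrier[of m n m] in auto)
qed

text \<open>While a product of elementary matrices is read from left to right, the number \<open>s\<close> counts how much of
  the run \<open>-m, -(m-1), \<dots>, -0\<close> has been met; the run is searched greedily, so \<open>-(m-s)\<close> is the index to
  wait for. The bound \<open>s \<le> m\<close> ends the search after \<open>-0\<close>, where \<open>m - s\<close> would be truncated.\<close>

definition run_step :: "nat \<Rightarrow> nat \<Rightarrow> tuple_index \<Rightarrow> nat" where
  "run_step m s t = (if s \<le> m \<and> t = NonPos (m - s) then Suc s else s)"

text \<open>The factors that disturb the block row \<open>s \<le> m\<close>. Both \<open>M\<^sub>-\<^sub>(\<^sub>m\<^sub>-\<^sub>s\<^sub>+\<^sub>1\<^sub>)(X)\<close> and \<open>M\<^sub>m\<^sub>-\<^sub>s\<^sub>+\<^sub>1(X)\<close> act on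
  the blocks \<open>s - 1\<close> and \<open>s\<close>, where their lower block rows are \<open>(I, X)\<close> and \<open>(I, 0)\<close>; \<open>M\<^sub>m\<^sub>-\<^sub>s(X)\<close> acts on
  the blocks \<open>s\<close> and \<open>s + 1\<close> with the upper block row \<open>(X, I)\<close>. At the ends, \<open>M\<^sub>-\<^sub>m(X)\<close> for \<open>s = 1\<close> and
  \<open>M\<^sub>0(X)\<close> for \<open>s = m\<close> multiply the block row by \<open>X\<close>. For \<open>s = m + 1\<close> the run is complete while the block
  row is still the last one, so the set is the one for \<open>s = m\<close> with \<open>-0\<close> added.\<close>

definition blocking :: "nat \<Rightarrow> nat \<Rightarrow> tuple_index \<Rightarrow> bool" where
  "blocking m s t \<longleftrightarrow> t \<in> {NonPos (Suc (m - s)), NonNeg (m - s), NonNeg (Suc (m - s))} \<or>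
     (m < s \<and> t = NonPos 0)"

text \<open>A factor that does not disturb the block row \<open>s\<close> either acts on other blocks only, or it is the one at
  the index \<open>-(m-s)\<close>, whose upper block row is \<open>(0, I)\<close>. The result is the same for every \<open>X\<close>, which is
  why the matrix assignments leave no trace in the formulas for eigenvectors.\<close>

lemma block_row_elem_mat:
  assumes m: "m \<ge> 2" and t: "elem_index m t" and X: "X \<in> carrier_mat n n"
    and s: "1 \<le> s" "s \<le> m" and nb: "\<not> blocking m s t"
  shows "block_row m n s * elem_mat m n t X = block_row m n (run_step m s t)"
  using t m
proof (cases rule: elem_index_cases)
  case 1
  then have "s \<le> m - 1" using nb s by (auto simp: blocking_def)
  then have "s * n \<le> (m - 1) * n" by simp
  then show ?thesis
    unfolding 1 elem_mat_pad_diag(1)[OF X m]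
    using block_row_pad_diag_outside[OF X pad_sizes(1)[OF m] s] by (simp add: run_step_def)
next
  case 2
  then have s2: "2 \<le> s" using nb s by (cases "s = 1") (auto simp: blocking_def)
  then have "1 * n \<le> (s - 1) * n" by (intro mult_right_mono) auto
  moreover have "m - s \<noteq> m" using s2 s by simp
  ultimately show ?thesis
    unfolding 2 elem_mat_pad_diag(2)[OF X m]
    using block_row_pad_diag_outside[OF X pad_sizes(2)[OF m] s] by (simp add: run_step_def)
next
  case (3 i)
  have "i < m - s \<or> Suc (m - s) < i" using nb 3 by (auto simp: blocking_def)
  then have "s \<le> m - i - 1 \<or> (m - i - 1) + 2 \<le> s - 1" using 3 s by auto
  then have "s * n \<le> (m - i - 1) * n \<or> ((m - i - 1) + 2) * n \<le> (s - 1) * n"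
    using mult_le_mono1[of _ _ n] by blast
  then have "s * n \<le> (m - i - 1) * n \<or> (m - i - 1) * n + (n + n) \<le> (s - 1) * n"
    by (simp only: add_mult_distrib mult_2)
  then show ?thesis
    unfolding 3(3) elem_mat_pad_diag(3)[OF X m 3(1,2)]
    using block_row_pad_diag_outside[OF swap_blocks_carrier(1)[OF X] pad_sizes(3)[OF m 3(1,2)] s]
    by (simp add: run_step_def)
next
  case (4 i)
  show ?thesis
  proof (cases "i = m - s")
    case True
    then have "m - i - 1 = s - 1" "s < m" using 4 s by auto
    then show ?thesis
      unfolding 4(3) elem_mat_pad_diag(4)[OF X m 4(1,2)]
      using block_row_pad_diag_swap[OF X _ s(1), of "(i - 1) * n" m] pad_sizes(3)[OF m 4(1,2), of n] True
      by (simp add: run_step_def)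
  next
    case False
    then have "i < m - s \<or> Suc (m - s) < i" using nb 4 by (auto simp: blocking_def)
    then have "s \<le> m - i - 1 \<or> (m - i - 1) + 2 \<le> s - 1" using 4 s by auto
    then have "s * n \<le> (m - i - 1) * n \<or> ((m - i - 1) + 2) * n \<le> (s - 1) * n"
      using mult_le_mono1[of _ _ n] by blast
    then have "s * n \<le> (m - i - 1) * n \<or> (m - i - 1) * n + (n + n) \<le> (s - 1) * n"
      by (simp only: add_mult_distrib mult_2)
    then show ?thesis
      unfolding 4(3) elem_mat_pad_diag(4)[OF X m 4(1,2)]
      using block_row_pad_diag_outside[OF swap_blocks_carrier(2)[OF X] pad_sizes(3)[OF m 4(1,2)] s] False
      by (simp add: run_step_def)
  qed
qed

text \<open>The block row reached after \<open>s\<close> elements of the run. The last element \<open>-0\<close> does not move the row but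
  multiplies it by a matrix \<open>B\<close>, which will be \<open>(-A\<^sub>0)\<^sup>-\<^sup>1\<close>.\<close>

definition tracked_row :: "nat \<Rightarrow> nat \<Rightarrow> complex mat \<Rightarrow> nat \<Rightarrow> complex mat" where
  "tracked_row m n B s = (if s \<le> m then block_row m n s else B * block_row m n m)"

lemma tracked_row_carrier:
  "B \<in> carrier_mat n n \<Longrightarrow> tracked_row m n B s \<in> carrier_mat n (m * n)"
  using block_row_carrier by (auto simp: tracked_row_def)

lemma tracked_row_elem_mat:
  assumes m: "m \<ge> 2" and t: "elem_index m t" and X: "X \<in> carrier_mat n n" and B: "B \<in> carrier_mat n n"
    and s: "1 \<le> s" and nb: "\<not> blocking m s t"
  shows "tracked_row m n B s * elem_mat m n t X = tracked_row m n B (run_step m s t)"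
proof (cases "s \<le> m")
  case True
  then have "run_step m s t \<le> m" using t by (cases "s = m") (auto simp: run_step_def)
  then show ?thesis using block_row_elem_mat[OF m t X s True nb] True by (simp add: tracked_row_def)
next
  case False
  then have "\<not> blocking m m t" "run_step m m t = m" using nb t by (auto simp: blocking_def run_step_def)
  then have "block_row m n m * elem_mat m n t X = block_row m n m"
    using block_row_elem_mat[OF m t X _ le_refl] m by simp
  then have "B * block_row m n m * elem_mat m n t X = B * block_row m n m"
    using assoc_mult_mat[OF B block_row_carrier elem_mat_carrier[OF m t X]] by simp
  then show ?thesis using False by (simp add: tracked_row_def run_step_def)
qed

lemma elem_mat_P_NonPos: "i \<noteq> 0 \<Longrightarrow> elem_mat_P m n A (NonPos i) = elem_mat m n (NonPos i) (A i)"
  by simp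

text \<open>The factor \<open>M\<^sub>-\<^sub>0\<^sup>P\<close> is available only as an inverse; everything about it is deduced from the
  last two equations.\<close>

lemma inverse_M0:
  assumes m: "m \<ge> 2" and A0: "A 0 \<in> carrier_mat n n" and d: "det (A 0) \<noteq> 0"
  defines "E \<equiv> elem_mat m n (NonNeg 0) (- A 0)"
  shows "E \<in> carrier_mat (m * n) (m * n)" "det E \<noteq> 0"
    "elem_mat_P m n A (NonPos 0) \<in> carrier_mat (m * n) (m * n)"
    "E * elem_mat_P m n A (NonPos 0) = 1\<^sub>m (m * n)" "elem_mat_P m n A (NonPos 0) * E = 1\<^sub>m (m * n)"
proof -
  have A0': "- A 0 \<in> carrier_mat n n" using A0 by simp
  have t: "elem_index m (NonNeg 0)" using m by simp
  obtain G where G: "G \<in> carrier_mat n n" "A 0 * G = 1\<^sub>m n" using inverse_if_det_nonzero[OF A0 d] by blast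
  have "- A 0 * - G = 1\<^sub>m n" using A0 G by simp
  then have d': "det (- A 0) \<noteq> 0" using det_nonzero_if_inverse[OF A0', of "- G"] G(1) by auto
  show E: "E \<in> carrier_mat (m * n) (m * n)" unfolding E_def by (rule elem_mat_carrier[OF m t A0'])
  show dE: "det E \<noteq> 0" unfolding E_def by (rule det_elem_mat_nonzero[OF m t A0' d'])
  have "elem_mat_P m n A (NonPos 0) = mat_inv E" unfolding E_def by simp
  then show "elem_mat_P m n A (NonPos 0) \<in> carrier_mat (m * n) (m * n)"
    "E * elem_mat_P m n A (NonPos 0) = 1\<^sub>m (m * n)" "elem_mat_P m n A (NonPos 0) * E = 1\<^sub>m (m * n)"
    using mat_inv_inverse[OF E dE] by simp_all
qed

text \<open>For the index \<open>-0\<close> the identity for \<open>M\<^sub>0\<^sup>P\<close> is multiplied by its inverse from the right: from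
  \<open>R M\<^sub>0\<^sup>P = R\<close> one gets \<open>R M\<^sub>-\<^sub>0\<^sup>P = R\<close> for the rows \<open>R\<close> other than the last, and from
  \<open>R M\<^sub>0\<^sup>P = -A\<^sub>0 R\<close> one gets \<open>R M\<^sub>-\<^sub>0\<^sup>P = (-A\<^sub>0)\<^sup>-\<^sup>1 R\<close> for the last one.\<close>

lemma tracked_row_elem_mat_P:
  assumes m: "m \<ge> 2" and i: "i \<le> m" and A: "\<forall>i\<le>m. A i \<in> carrier_mat n n"
    and s: "1 \<le> s" and nb: "\<not> blocking m s (NonPos i)"
    and d: "i = 0 \<Longrightarrow> det (A 0) \<noteq> 0"
    and B: "i = 0 \<Longrightarrow> B = - mat_inv (A 0)" "B \<in> carrier_mat n n"
  shows "tracked_row m n B s * elem_mat_P m n A (NonPos i) = tracked_row m n B (run_step m s (NonPos i))"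
proof (cases "i = 0")
  case False
  then have "elem_index m (NonPos i)" "A i \<in> carrier_mat n n" using i A by auto
  then show ?thesis
    unfolding elem_mat_P_NonPos[OF False] using tracked_row_elem_mat[OF m _ _ B(2) s nb] by blast
next
  case i0: True
  have A0: "A 0 \<in> carrier_mat n n" using A by simp
  note A0i = mat_inv_inverse[OF A0 d[OF i0]]
  note E = inverse_M0[where A = A, OF m A0 d[OF i0]]
  let ?E = "elem_mat m n (NonNeg 0) (- A 0)" and ?Ei = "elem_mat_P m n A (NonPos 0)"
  note Ei = E(3)
  have sm: "s \<le> m" using nb i0 by (auto simp: blocking_def)
  show ?thesis
  proof (cases "s = m")
    case False
    have "elem_index m (NonNeg 0)" "\<not> blocking m s (NonNeg 0)" "run_step m s (NonNeg 0) = s"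
      "run_step m s (NonPos 0) = s"
      using m sm False by (auto simp: blocking_def run_step_def)
    moreover from this have "block_row m n s * ?E = block_row m n s"
      using block_row_elem_mat[OF m _ _ s sm, of "NonNeg 0" "- A 0" n] A0 by simp
    then have "block_row m n s * ?Ei = block_row m n s * ?E * ?Ei" by simp
    then have "block_row m n s * ?Ei = block_row m n s"
      using assoc_mult_mat[OF block_row_carrier E(1,3)] E(4) right_mult_one_mat[OF block_row_carrier]
      by simp
    ultimately show ?thesis using sm i0 by (simp add: tracked_row_def del: elem_mat_P.simps)
  next
    case True
    have A0': "- A 0 \<in> carrier_mat n n" using A0 by simp
    have BA: "B * - A 0 = 1\<^sub>m n" using A0 A0i by (simp add: B(1)[OF i0])
    have "block_row m n m * ?E = - A 0 * block_row m n m"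
      using block_row_last_pad_diag[OF A0'] elem_mat_pad_diag(1)[OF A0' m] m by simp
    then have "B * (block_row m n m * ?E) = B * - A 0 * block_row m n m"
      using assoc_mult_mat[OF B(2) A0' block_row_carrier] by simp
    also have "\<dots> = block_row m n m" unfolding BA by (rule left_mult_one_mat[OF block_row_carrier])
    finally have "B * block_row m n m * ?E = block_row m n m"
      using assoc_mult_mat[OF B(2) block_row_carrier E(1)] by simp
    then have "block_row m n m * ?Ei = B * block_row m n m * ?E * ?Ei" by simp
    also have "\<dots> = B * block_row m n m * (?E * ?Ei)"
      using assoc_mult_mat[OF mult_carrier_mat[OF B(2) block_row_carrier] E(1,3)] .
    also have "\<dots> = B * block_row m n m"
      unfolding E(4) by (rule right_mult_one_mat[OF mult_carrier_mat[OF B(2) block_row_carrier]])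
    finally show ?thesis using True i0 by (simp add: tracked_row_def run_step_def del: elem_mat_P.simps)
  qed
qed

section \<open>Runs and the Successor Infix Property\<close>

lemma run_step_le: "s \<le> Suc m \<Longrightarrow> run_step m s t \<le> Suc m" "s \<le> run_step m s t"
  by (auto simp: run_step_def)

lemma foldl_run_step_le: "s \<le> Suc m \<Longrightarrow> foldl (run_step m) s ts \<le> Suc m"
  by (induction ts arbitrary: s) (auto simp: run_step_le)

lemma foldl_run_step_ge: "s \<le> foldl (run_step m) s ts"
proof (induction ts arbitrary: s)
  case (Cons t ts)
  show ?case using run_step_le(2)[of s m t] Cons[of "run_step m s t"] by simp
qed simp

text \<open>Greedy search finds the longest run. The general starting value \<open>s\<close> makes the induction work.\<close>

lemma subseq_run_iff:
  assumes "s \<le> k" "k \<le> Suc m"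
  shows "subseq (map (\<lambda>j. NonPos (m - j)) [s..<k]) ts \<longleftrightarrow> k \<le> foldl (run_step m) s ts"
  using assms
proof (induction ts arbitrary: s)
  case Nil
  then show ?case by (auto dest!: list_emb_Nil2)
next
  case (Cons t ts)
  show ?case
  proof (cases "s = k")
    case True
    then show ?thesis using foldl_run_step_ge[of k m "t # ts"] by simp
  next
    case False
    then have l: "map (\<lambda>j. NonPos (m - j)) [s..<k] = NonPos (m - s) # map (\<lambda>j. NonPos (m - j)) [Suc s..<k]"
      using Cons.prems by (simp add: upt_conv_Cons)
    show ?thesis
    proof (cases "t = NonPos (m - s)")
      case True
      then show ?thesis unfolding l using Cons.IH[of "Suc s"] Cons.prems False
        by (simp add: run_step_def)
    next
      case t: False
      then show ?thesis using Cons.IH[of s] Cons.prems False unfolding l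
        by (simp add: run_step_def subseq_Cons2_neq)
    qed
  qed
qed

lemma run_mem_if_reached:
  assumes "j < foldl (run_step m) 0 ts"
  shows "NonPos (m - j) \<in> set ts"
proof -
  let ?e = "foldl (run_step m) 0 ts"
  have "subseq (map (\<lambda>j. NonPos (m - j)) [0..<?e]) ts"
    using subseq_run_iff[of 0 ?e m ts] foldl_run_step_le[of 0 m ts] by simp
  moreover have "NonPos (m - j) \<in> set (map (\<lambda>j. NonPos (m - j)) [0..<?e])"
    using assms by auto
  ultimately show ?thesis by (rule list_emb_set) simp
qed

lemma is_run_NonPos_iff:
  "is_run (NonPos i) p us \<longleftrightarrow> p \<le> i \<and> us = map (\<lambda>j. NonPos (i - j)) [0..<Suc p]"
proof (induction p arbitrary: i us)
  case 0
  show ?case by (cases us) (auto simp: is_run_def)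
next
  case (Suc p)
  have upt: "map (\<lambda>j. NonPos (i - j)) [0..<Suc (Suc p)] =
      NonPos i # map (\<lambda>j. NonPos (i - Suc j)) [0..<Suc p]"
    by (simp add: upt_conv_Cons map_Suc_upt[symmetric] comp_def del: upt_Suc)
  show ?case
  proof
    assume r: "is_run (NonPos i) (Suc p) us"
    then obtain y ys where us: "us = NonPos i # y # ys"
      unfolding is_run_def by (cases us; cases "tl us") auto
    then have y: "is_succ (NonPos i) y" and ys: "length (y # ys) = Suc p" "successively is_succ (y # ys)"
      using r unfolding is_run_def by auto
    then obtain l where l: "i = Suc l" "y = NonPos l" by (cases i) auto
    then have "is_run (NonPos l) p (y # ys)" using ys by (simp add: is_run_def)
    then show "Suc p \<le> i \<and> us = map (\<lambda>j. NonPos (i - j)) [0..<Suc (Suc p)]"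
      unfolding Suc.IH upt using us l by simp
  next
    assume r: "Suc p \<le> i \<and> us = map (\<lambda>j. NonPos (i - j)) [0..<Suc (Suc p)]"
    then obtain l where l: "i = Suc l" by (cases i) auto
    then have "is_run (NonPos l) p (map (\<lambda>j. NonPos (l - j)) [0..<Suc p])" using Suc.IH r by simp
    moreover have "us = NonPos (Suc l) # map (\<lambda>j. NonPos (l - j)) [0..<Suc p]"
      using r unfolding upt by (simp add: l)
    ultimately show "is_run (NonPos i) (Suc p) us"
      unfolding is_run_def l by (auto simp: successively_Cons simp del: upt_Suc)
  qed
qed

text \<open>The number of consecutions is one less than the length of the longest run; for a tuple without \<open>-m\<close>
  both sides are \<open>-1\<close>.\<close>

lemma consecutions_eq_foldl: "consecutions (NonPos m) ts = int (foldl (run_step m) 0 ts) - 1"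
proof -
  let ?e = "foldl (run_step m) 0 ts"
  have e: "?e \<le> Suc m" by (rule foldl_run_step_le) simp
  have run: "(\<exists>us. is_run (NonPos m) p us \<and> subseq us ts) \<longleftrightarrow> Suc p \<le> ?e" for p
    using subseq_run_iff[of 0 "Suc p" m ts] e by (auto simp: is_run_NonPos_iff simp del: upt_Suc)
  have mem: "NonPos m \<in> set ts \<longleftrightarrow> 1 \<le> ?e"
    using subseq_run_iff[of 0 1 m ts] by (simp add: subseq_singleton_left)
  have "(THE p. Suc p \<le> ?e \<and> \<not> Suc (Suc p) \<le> ?e) = ?e - 1" if "1 \<le> ?e"
    using that by (intro the_equality) auto
  then show ?thesis
    unfolding consecutions_def run mem by auto
qed

lemma subseq_rev_iff: "subseq (rev xs) ys \<longleftrightarrow> subseq xs (rev ys)"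
proof -
  have "subseq (rev xs) (rev ys)" if "subseq xs ys" for xs ys :: "'a list"
    using that by induction (auto intro: subseq_rev_drop_many)
  from this[of "rev xs" ys] this[of xs "rev ys"] show ?thesis by auto
qed

text \<open>This reduces left eigenvectors to right ones, as transposition reverses products.\<close>

lemma inversions_eq_consecutions_rev: "inversions t ts = consecutions t (rev ts)"
  by (simp add: inversions_def consecutions_def subseq_rev_iff)

text \<open>A formulation by factorizations instead of positions, from which it is plain that the property
  passes to infixes and to reversed tuples.\<close>

lemma SIP_iff_split:
  "SIP w \<longleftrightarrow> (\<forall>p x v q. w = p @ x # v @ x # q \<longrightarrow> (\<exists>y\<in>set v. is_succ x y))"
proof
  assume S: "SIP w"
  show "\<forall>p x v q. w = p @ x # v @ x # q \<longrightarrow> (\<exists>y\<in>set v. is_succ x y)"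
  proof (intro allI impI)
    fix p x v q assume w: "w = p @ x # v @ x # q"
    let ?a = "length p" and ?b = "Suc (length p + length v)"
    have "w ! ?a = x" "w ! ?b = x" "?a < ?b" "?b < length w" by (auto simp: w nth_append)
    then obtain c where c: "?a < c" "c < ?b" "is_succ x (w ! c)" using S unfolding SIP_def by metis
    then have "w ! c = v ! (c - Suc ?a)" "c - Suc ?a < length v" by (auto simp: w nth_append nth_Cons')
    then show "\<exists>y\<in>set v. is_succ x y" using c by (metis nth_mem)
  qed
next
  assume R: "\<forall>p x v q. w = p @ x # v @ x # q \<longrightarrow> (\<exists>y\<in>set v. is_succ x y)"
  show "SIP w"
    unfolding SIP_def
  proof (intro allI impI)
    fix a b assume ab: "a < b \<and> b < length w \<and> w ! a = w ! b"
    let ?v = "take (b - Suc a) (drop (Suc a) w)"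
    have "w = take a w @ w ! a # drop (Suc a) w" using ab by (metis id_take_nth_drop less_trans)
    moreover have "drop (Suc a) w = ?v @ drop b w"
      using ab by (metis append_take_drop_id drop_drop le_add_diff_inverse2 Suc_leI)
    moreover have "drop b w = w ! a # drop (Suc b) w" using ab by (simp add: Cons_nth_drop_Suc)
    ultimately have "w = take a w @ w ! a # ?v @ w ! a # drop (Suc b) w" by simp
    then obtain y where y: "y \<in> set ?v" "is_succ (w ! a) y" using R by blast
    then obtain k where k: "k < b - Suc a" "y = w ! (Suc a + k)" using ab
      by (auto simp: in_set_conv_nth)
    then show "\<exists>c. a < c \<and> c < b \<and> is_succ (w ! a) (w ! c)"
      using y by (intro exI[of _ "Suc a + k"]) auto
  qed
qed

lemma SIP_appendD: "SIP (u @ v) \<Longrightarrow> SIP v" "SIP (u @ v) \<Longrightarrow> SIP u"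
proof -
  assume S: "SIP (u @ v)"
  show "SIP v" unfolding SIP_iff_split
  proof (intro allI impI)
    fix p x w q assume "v = p @ x # w @ x # q"
    then have "u @ v = (u @ p) @ x # w @ x # q" by simp
    then show "\<exists>y\<in>set w. is_succ x y" using S unfolding SIP_iff_split by blast
  qed
  show "SIP u" unfolding SIP_iff_split
  proof (intro allI impI)
    fix p x w q assume "u = p @ x # w @ x # q"
    then have "u @ v = p @ x # w @ x # (q @ v)" by simp
    then show "\<exists>y\<in>set w. is_succ x y" using S unfolding SIP_iff_split by blast
  qed
qed

lemma SIP_rev:
  assumes "SIP w" shows "SIP (rev w)"
  unfolding SIP_iff_split
proof (intro allI impI)
  fix p x v q assume "rev w = p @ x # v @ x # q"
  then have "w = rev (p @ x # v @ x # q)" by (metis rev_rev_ident)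
  then have "w = rev q @ x # rev v @ x # rev p" by simp
  then show "\<exists>y\<in>set v. is_succ x y" using assms unfolding SIP_iff_split by (metis set_rev)
qed

text \<open>The search is at \<open>s\<close> because \<open>-(m-s+1)\<close> came, and it has been waiting for \<open>-(m-s)\<close> ever since.\<close>

lemma last_run_step_split:
  assumes "1 \<le> foldl (run_step m) 0 u"
  defines "s \<equiv> foldl (run_step m) 0 u"
  shows "\<exists>p v. u = p @ NonPos (m - (s - 1)) # v \<and> (s \<le> m \<longrightarrow> NonPos (m - s) \<notin> set v)"
  using assms(1) unfolding s_def
proof (induction u rule: rev_induct)
  case (snoc t u)
  let ?e = "foldl (run_step m) 0 u"
  show ?case
  proof (cases "?e \<le> m \<and> t = NonPos (m - ?e)")
    case True
    then have "foldl (run_step m) 0 (u @ [t]) = Suc ?e" "u @ [t] = u @ NonPos (m - ?e) # []"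
      by (auto simp: run_step_def)
    then show ?thesis by (metis diff_Suc_1 empty_iff empty_set)
  next
    case False
    then have e: "foldl (run_step m) 0 (u @ [t]) = ?e" by (auto simp: run_step_def)
    then obtain p v where "u = p @ NonPos (m - (?e - 1)) # v" "?e \<le> m \<longrightarrow> NonPos (m - ?e) \<notin> set v"
      using snoc by auto
    then show ?thesis
      unfolding e using False by (intro exI[of _ p] exI[of _ "v @ [t]"]) auto
  qed
qed simp

text \<open>The index \<open>-(m-s+1)\<close> has brought the search to \<open>s\<close>. If it came again, the Successor Infix Property
  would put \<open>-(m-s)\<close> between the two occurrences, and the search would have gone on to \<open>s + 1\<close>.\<close>

lemma SIP_no_return:
  assumes S: "SIP (u @ t # r)" and s: "s = foldl (run_step m) 0 u" "1 \<le> s" "s \<le> m"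
  shows "t \<noteq> NonPos (Suc (m - s))"
proof
  assume t: "t = NonPos (Suc (m - s))"
  have "m - (s - 1) = Suc (m - s)" using s by simp
  then obtain p v where u: "u = p @ NonPos (Suc (m - s)) # v" "NonPos (m - s) \<notin> set v"
    using last_run_step_split[of m u] s by auto
  then have "u @ t # r = p @ t # v @ t # r" using t by simp
  then obtain y where "y \<in> set v" "is_succ t y" using S unfolding SIP_iff_split by blast
  then show False using u t by simp
qed

section \<open>Products of matrices\<close>

lemma foldr_mult_carrier:
  "set Es \<subseteq> carrier_mat N N \<Longrightarrow> foldr (*) Es (1\<^sub>m N) \<in> carrier_mat N N"
  by (induction Es) auto

lemma foldr_mult_append:
  fixes Es :: "complex mat list"
  assumes "set Es \<subseteq> carrier_mat N N" "set Fs \<subseteq> carrier_mat N N"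
  shows "foldr (*) (Es @ Fs) (1\<^sub>m N) = foldr (*) Es (1\<^sub>m N) * foldr (*) Fs (1\<^sub>m N)"
  using assms(1)
proof (induction Es)
  case Nil
  then show ?case using foldr_mult_carrier[OF assms(2)] by simp
next
  case (Cons E Es)
  then have "E \<in> carrier_mat N N" "foldr (*) Es (1\<^sub>m N) \<in> carrier_mat N N"
    using foldr_mult_carrier by auto
  then show ?case using Cons foldr_mult_carrier[OF assms(2)] by (simp add: assoc_mult_mat[of _ N N _ N _ N])
qed

lemma foldr_mult_det_nonzero:
  fixes Es :: "complex mat list"
  assumes "set Es \<subseteq> carrier_mat N N" "\<And>E. E \<in> set Es \<Longrightarrow> det E \<noteq> 0"
  shows "det (foldr (*) Es (1\<^sub>m N)) \<noteq> 0"
  using assms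
proof (induction Es)
  case (Cons E Es)
  then show ?case using foldr_mult_carrier[of Es N] det_mult[of E N "foldr (*) Es (1\<^sub>m N)"] by auto
qed simp

lemma foldr_mult_transpose:
  fixes Es :: "complex mat list"
  assumes "set Es \<subseteq> carrier_mat N N"
  shows "(foldr (*) Es (1\<^sub>m N))\<^sup>T = foldr (*) (map transpose_mat (rev Es)) (1\<^sub>m N)"
  using assms
proof (induction Es)
  case (Cons E Es)
  then have c: "E \<in> carrier_mat N N" "set Es \<subseteq> carrier_mat N N" by auto
  then have c': "set (map transpose_mat (rev Es)) \<subseteq> carrier_mat N N" by auto
  have "(foldr (*) (E # Es) (1\<^sub>m N))\<^sup>T = (foldr (*) Es (1\<^sub>m N))\<^sup>T * E\<^sup>T"
    using transpose_mult[OF c(1) foldr_mult_carrier[OF c(2)]] by simp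
  also have "\<dots> = foldr (*) (map transpose_mat (rev Es)) (1\<^sub>m N) * foldr (*) [E\<^sup>T] (1\<^sub>m N)"
    using Cons c by simp
  also have "\<dots> = foldr (*) (map transpose_mat (rev Es) @ [E\<^sup>T]) (1\<^sub>m N)"
    using foldr_mult_append[OF c', of "[E\<^sup>T]"] c by simp
  finally show ?case by simp
qed simp

text \<open>Following a family of rows \<open>R s\<close> through a product: if each factor takes the current row of the family to
  the next one, the product takes the first to the last.\<close>

lemma row_walk:
  fixes R :: "nat \<Rightarrow> complex mat"
  assumes "length Es = length ts" "set Es \<subseteq> carrier_mat N N" "\<And>s. R s \<in> carrier_mat d N"
    and "\<And>u t r. ts = u @ t # r \<Longrightarrow>
      R (foldl f s u) * Es ! length u = R (f (foldl f s u) t)"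
  shows "R s * foldr (*) Es (1\<^sub>m N) = R (foldl f s ts)"
  using assms(1,2,4)
proof (induction Es ts arbitrary: s rule: list_induct2)
  case Nil
  then show ?case using assms(3)[of s] by simp
next
  case (Cons E Es t ts)
  have c: "E \<in> carrier_mat N N" "foldr (*) Es (1\<^sub>m N) \<in> carrier_mat N N"
    using Cons.prems(1) foldr_mult_carrier by auto
  have "R s * foldr (*) (E # Es) (1\<^sub>m N) = R s * E * foldr (*) Es (1\<^sub>m N)"
    using assoc_mult_mat[OF assms(3) c] by simp
  also have "R s * E = R (f s t)" using Cons.prems(2)[of "[]" t ts] by simp
  also have "R (f s t) * foldr (*) Es (1\<^sub>m N) = R (foldl f (f s t) ts)"
  proof (rule Cons.IH)
    fix u t' r assume "ts = u @ t' # r"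
    then show "R (foldl f (f s t) u) * Es ! length u = R (f (foldl f (f s t) u) t')"
      using Cons.prems(2)[of "t # u" t' r] by simp
  qed (use Cons.prems in simp)
  finally show ?case by simp
qed

section \<open>The kernel of a product around \<open>diag(X, I)\<close>\<close>

lemma first_block_row_vec:
  assumes m: "1 \<le> m" and w: "w \<in> carrier_vec (m * n)"
  shows "block_row m n 1 *\<^sub>v w = vec_first w n"
proof (rule eq_vecI)
  fix r assume "r < dim_vec (vec_first w n)"
  then have r: "r < n" by simp
  have rN: "r < m * n" using block_row_bound[OF _ m r] by simp
  have "(block_row m n 1 *\<^sub>v w) $ r = (\<Sum>l = 0..<m * n. (if l = r then 1 else 0) * w $ l)"
    using r w m by (simp add: block_row_eq scalar_prod_def)
  also have "\<dots> = (\<Sum>l = 0..<m * n. if l = r then w $ l else 0)" by (intro sum.cong) auto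
  also have "\<dots> = w $ r" using rN by simp
  finally show "(block_row m n 1 *\<^sub>v w) $ r = vec_first w n $ r" using r by (simp add: vec_first_def)
qed (use block_row_carrier[of m n 1] in auto)

text \<open>The kernel of \<open>diag(X, I)\<close> consists of the vectors \<open>(x, 0)\<close> with \<open>X x = 0\<close>, so taking the first block
  identifies it with the kernel of \<open>X\<close>. The invertible factor \<open>U\<close> does not change a kernel and \<open>W\<close> only
  transports it. The scalar \<open>c\<close> serves to correct a sign.\<close>

lemma bij_betw_kernels:
  fixes U W X :: "complex mat"
  assumes m: "m \<ge> 2" and X: "X \<in> carrier_mat n n"
    and U: "U \<in> carrier_mat (m * n) (m * n)" "det U \<noteq> 0"
    and W: "W \<in> carrier_mat (m * n) (m * n)" "det W \<noteq> 0"
    and c: "c \<noteq> 0"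
  defines "D \<equiv> elem_mat m n (NonPos m) X"
  shows "bij_betw (\<lambda>v. (c \<cdot>\<^sub>m (block_row m n 1 * W)) *\<^sub>v v) (mat_kernel (U * (D * W))) (mat_kernel X)"
proof -
  let ?N = "m * n" and ?b = "(m - 1) * n"
  let ?F = "c \<cdot>\<^sub>m (block_row m n 1 * W)"
  have N: "?N = n + ?b" using m by (cases m) auto
  have D: "D \<in> carrier_mat ?N ?N" unfolding D_def using m by (intro elem_mat_carrier[OF m _ X]) simp
  have D4: "D = four_block_mat X (0\<^sub>m n ?b) (0\<^sub>m ?b n) (1\<^sub>m ?b)"
    using X by (simp add: D_def diag_block_mat.simps(2)[of X] Let_def del: diag_block_mat.simps)
  obtain U' where U': "U' \<in> carrier_mat ?N ?N" "U' * U = 1\<^sub>m ?N"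
    using inverse_if_det_nonzero[OF U] by blast
  obtain W' where W': "W' \<in> carrier_mat ?N ?N" "W * W' = 1\<^sub>m ?N" "W' * W = 1\<^sub>m ?N"
    using inverse_if_det_nonzero[OF W] by blast
  have DW: "D * W \<in> carrier_mat ?N ?N" using D W by simp
  have ker: "mat_kernel (U * (D * W)) = mat_kernel (D * W)"
    by (rule mat_kernel_mult_eq[OF DW U(1) U'])
  have Fv: "?F *\<^sub>v v = c \<cdot>\<^sub>v vec_first (W *\<^sub>v v) n" if v: "v \<in> carrier_vec ?N" for v
  proof -
    have "(c \<cdot>\<^sub>m M) *\<^sub>v v = c \<cdot>\<^sub>v (M *\<^sub>v v)" if "M \<in> carrier_mat n ?N" for M
      using that v by (intro eq_vecI) auto
    then have "?F *\<^sub>v v = c \<cdot>\<^sub>v (block_row m n 1 * W *\<^sub>v v)"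
      using mult_carrier_mat[OF block_row_carrier W(1)] by blast
    also have "block_row m n 1 * W *\<^sub>v v = block_row m n 1 *\<^sub>v (W *\<^sub>v v)"
      by (rule assoc_mult_mat_vec[OF block_row_carrier W(1) v])
    also have "\<dots> = vec_first (W *\<^sub>v v) n"
      using m W v by (intro first_block_row_vec) auto
    finally show ?thesis .
  qed
  have kerD: "D *\<^sub>v (x @\<^sub>v y) = 0\<^sub>v ?N \<longleftrightarrow> X *\<^sub>v x = 0\<^sub>v n \<and> y = 0\<^sub>v ?b"
    if x: "x \<in> carrier_vec n" and y: "y \<in> carrier_vec ?b" for x y
  proof -
    have z: "0\<^sub>m n ?b *\<^sub>v y = 0\<^sub>v n" "0\<^sub>m ?b n *\<^sub>v x = 0\<^sub>v ?b" "1\<^sub>m ?b *\<^sub>v y = y"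
      using x y by (intro eq_vecI; simp)+
    have "X *\<^sub>v x \<in> carrier_vec n" using X x by simp
    then have "D *\<^sub>v (x @\<^sub>v y) = (X *\<^sub>v x) @\<^sub>v y"
      unfolding D4 four_block_mat_mult_vec[OF X zero_carrier_mat zero_carrier_mat one_carrier_mat x y] z
      using y by simp
    moreover have "0\<^sub>v ?N = 0\<^sub>v n @\<^sub>v (0\<^sub>v ?b :: complex vec)" unfolding N by auto
    moreover have "X *\<^sub>v x \<in> carrier_vec n" using X x by simp
    ultimately show ?thesis using append_vec_eq[of "X *\<^sub>v x" n "0\<^sub>v n" y "0\<^sub>v ?b"] by simp
  qed
  have kerDW: "v \<in> mat_kernel (D * W) \<longleftrightarrow> v \<in> carrier_vec ?N \<and>
      X *\<^sub>v vec_first (W *\<^sub>v v) n = 0\<^sub>v n \<and> vec_last (W *\<^sub>v v) ?b = 0\<^sub>v ?b" for v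
  proof (cases "v \<in> carrier_vec ?N")
    case True
    have "D * W *\<^sub>v v = D *\<^sub>v (W *\<^sub>v v)" by (rule assoc_mult_mat_vec[OF D W(1) True])
    moreover have "W *\<^sub>v v \<in> carrier_vec (n + ?b)" using W True N by simp
    then have "vec_first (W *\<^sub>v v) n @\<^sub>v vec_last (W *\<^sub>v v) ?b = W *\<^sub>v v" by (rule vec_first_last_append)
    ultimately show ?thesis
      using True kerD[OF vec_first_carrier[of "W *\<^sub>v v"] vec_last_carrier[of "W *\<^sub>v v"]] by (simp add: mat_kernel[OF DW])
  next
    case False
    then show ?thesis by (simp add: mat_kernel[OF DW])
  qed
  have kerX: "c \<cdot>\<^sub>v x \<in> mat_kernel X" if "x \<in> carrier_vec n" "X *\<^sub>v x = 0\<^sub>v n" for x c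
    using mat_kernel_smult[OF X] mat_kernelI[OF X that] .
  show ?thesis
    unfolding ker bij_betw_def
  proof (intro conjI equalityI subsetI)
    show "inj_on (\<lambda>v. ?F *\<^sub>v v) (mat_kernel (D * W))"
    proof (rule inj_onI)
      fix v v'
      assume v: "v \<in> mat_kernel (D * W)" and v': "v' \<in> mat_kernel (D * W)"
        and eq: "?F *\<^sub>v v = ?F *\<^sub>v v'"
      note k = v[unfolded kerDW] v'[unfolded kerDW]
      have "c \<cdot>\<^sub>v vec_first (W *\<^sub>v v) n = c \<cdot>\<^sub>v vec_first (W *\<^sub>v v') n" using eq Fv k by metis
      then have "inverse c \<cdot>\<^sub>v (c \<cdot>\<^sub>v vec_first (W *\<^sub>v v) n) = inverse c \<cdot>\<^sub>v (c \<cdot>\<^sub>v vec_first (W *\<^sub>v v') n)"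
        by simp
      then have "vec_first (W *\<^sub>v v) n = vec_first (W *\<^sub>v v') n" using c by (simp add: smult_smult_assoc)
      moreover have "vec_last (W *\<^sub>v v) ?b = vec_last (W *\<^sub>v v') ?b" using k by simp
      moreover have "W *\<^sub>v v \<in> carrier_vec (n + ?b)" "W *\<^sub>v v' \<in> carrier_vec (n + ?b)"
        using W k N by auto
      ultimately have "W *\<^sub>v v = W *\<^sub>v v'" using vec_first_last_append by metis
      then have "W' *\<^sub>v (W *\<^sub>v v) = W' *\<^sub>v (W *\<^sub>v v')" by simp
      then show "v = v'"
        using assoc_mult_mat_vec[OF W'(1) W(1)] W'(3) k by (metis one_mult_mat_vec)
    qed
  next
    fix x assume "x \<in> (\<lambda>v. ?F *\<^sub>v v) ` mat_kernel (D * W)"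
    then obtain v where v: "v \<in> mat_kernel (D * W)" "x = ?F *\<^sub>v v" by auto
    show "x \<in> mat_kernel X"
      unfolding v(2) using v(1) kerX[OF vec_first_carrier[of "W *\<^sub>v v"]] Fv[of v] unfolding kerDW by metis
  next
    fix x assume x: "x \<in> mat_kernel X"
    then have xc: "x \<in> carrier_vec n" by (rule mat_kernelD(1)[OF X])
    let ?w = "(inverse c \<cdot>\<^sub>v x) @\<^sub>v 0\<^sub>v ?b"
    let ?v = "W' *\<^sub>v ?w"
    have w: "?w \<in> carrier_vec ?N" unfolding N using xc by simp
    have v: "?v \<in> carrier_vec ?N" using W'(1) w by (rule mult_mat_vec_carrier)
    have "W *\<^sub>v ?v = W * W' *\<^sub>v ?w" by (rule assoc_mult_mat_vec[OF W(1) W'(1) w, symmetric])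
    then have Wv: "W *\<^sub>v ?v = ?w" using W'(2) w by simp
    have f: "vec_first ?w n = inverse c \<cdot>\<^sub>v x" "vec_last ?w ?b = 0\<^sub>v ?b"
      using xc by (auto simp: vec_first_def vec_last_def)
    have "X *\<^sub>v (inverse c \<cdot>\<^sub>v x) = 0\<^sub>v n"
      using mat_kernelD(2)[OF X mat_kernel_smult[OF X x]] .
    then have "?v \<in> mat_kernel (D * W)" unfolding kerDW Wv f using v by simp
    moreover have "x = ?F *\<^sub>v ?v" unfolding Fv[OF v] Wv f using c by (simp add: smult_smult_assoc)
    ultimately show "x \<in> (\<lambda>v. ?F *\<^sub>v v) ` mat_kernel (D * W)" by blast
  qed
qed

section \<open>Products belonging to index tuples\<close>

declare elem_mat.simps [simp del] elem_mat_P.simps [simp del] diag_block_mat.simps [simp del]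

lemma tuple_mat_regular:
  assumes m: "m \<ge> 2" and t: "\<forall>i\<in>set t. elem_index m i" and X: "nonsingular_assignment m n t X"
  shows "set (map2 (elem_mat m n) t X) \<subseteq> carrier_mat (m * n) (m * n)"
    and "tuple_mat m n t X \<in> carrier_mat (m * n) (m * n)"
    and "det (tuple_mat m n t X) \<noteq> 0"
proof -
  have len: "length X = length t" and Xc: "set X \<subseteq> carrier_mat n n"
    and ns: "\<And>j. j < length t \<Longrightarrow> t ! j \<in> {NonNeg 0, NonPos 0, NonNeg m, NonPos m} \<Longrightarrow> invertible_mat (X ! j)"
    using X by (auto simp: nonsingular_assignment_def matrix_assignment_def)
  have E: "elem_mat m n (t ! j) (X ! j) \<in> carrier_mat (m * n) (m * n) \<and> det (elem_mat m n (t ! j) (X ! j)) \<noteq> 0"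
    if j: "j < length t" for j
  proof -
    have Xj: "X ! j \<in> carrier_mat n n" using Xc len j by (metis nth_mem subsetD)
    have tj: "elem_index m (t ! j)" using t j by simp
    have "det (X ! j) \<noteq> 0" if "t ! j \<in> {NonNeg 0, NonPos m}"
      using det_nonzero_if_invertible_mat[OF Xj ns[OF j]] that by auto
    then show ?thesis
      using elem_mat_carrier[OF m tj Xj] det_elem_mat_nonzero[OF m tj Xj] by simp
  qed
  have mem: "\<exists>j < length t. E = elem_mat m n (t ! j) (X ! j)" if "E \<in> set (map2 (elem_mat m n) t X)" for E
    using that len unfolding in_set_conv_nth by auto
  show c: "set (map2 (elem_mat m n) t X) \<subseteq> carrier_mat (m * n) (m * n)"
    using mem E by fastforce
  show "tuple_mat m n t X \<in> carrier_mat (m * n) (m * n)"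
    unfolding tuple_mat_def by (rule foldr_mult_carrier[OF c])
  show "det (tuple_mat m n t X) \<noteq> 0"
    unfolding tuple_mat_def
    by (rule foldr_mult_det_nonzero[OF c]) (use mem E in fastforce)
qed

lemma foldl_run_step_le_m:
  "s \<le> m \<Longrightarrow> NonPos 0 \<notin> set ts \<Longrightarrow> foldl (run_step m) s ts \<le> m"
proof (induction ts arbitrary: s)
  case (Cons t ts)
  then have "run_step m s t \<le> m" by (cases "s = m") (auto simp: run_step_def)
  then show ?case using Cons by simp
qed simp

lemma foldl_run_step_NonNeg: "set ts \<subseteq> range NonNeg \<Longrightarrow> foldl (run_step m) s ts = s"
proof (induction ts arbitrary: s)
  case (Cons t ts)
  then have "run_step m s t = s" by (auto simp: run_step_def)
  then show ?case using Cons by simp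
qed simp

section \<open>Following the first block row through a pencil\<close>

text \<open>The data on the right-hand side of an EGFP, with \<open>\<sigma>' = \<sigma>\<^sub>2\<close> and \<open>\<tau>' = \<tau>\<^sub>2\<close>. The left-hand side
  satisfies the same conditions after transposition, so that everything below can be used twice. That
  \<open>-m\<close> belongs to \<open>\<tau>\<close> and \<open>m\<close> not to \<open>\<sigma>\<close> is what the singularity of \<open>A\<^sub>m\<close> gives.\<close>

locale fiedler_side =
  fixes m n :: nat and A :: "nat \<Rightarrow> complex mat"
    and \<sigma> \<tau> \<sigma>' \<tau>' :: "tuple_index list" and X Y :: "complex mat list"
  assumes m: "m \<ge> 2"
    and A: "\<forall>i\<le>m. A i \<in> carrier_mat n n"
    and distinct: "distinct \<tau>"
    and first: "NonPos m \<in> set \<tau>"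
    and \<tau>_range: "set \<tau> \<subseteq> NonPos ` {..m}"
    and \<sigma>_range: "set \<sigma> \<subseteq> NonNeg ` {..<m}"
    and disjoint: "\<And>i. NonPos i \<in> set \<tau> \<Longrightarrow> NonNeg i \<notin> set \<sigma>"
    and A0: "NonPos 0 \<in> set \<tau> \<Longrightarrow> det (A 0) \<noteq> 0"
    and \<sigma>'_subset: "set \<sigma>' \<subseteq> set \<sigma>"
    and \<tau>'_subset: "set \<tau>' \<subseteq> set \<tau> - {NonPos 1, NonPos 0}"
    and SIP_\<sigma>: "SIP (\<sigma> @ \<sigma>')"
    and SIP_\<tau>: "SIP (\<tau> @ \<tau>')"
    and X: "nonsingular_assignment m n \<sigma>' X"
    and Y: "nonsingular_assignment m n \<tau>' Y"
begin

abbreviation "reach \<equiv> foldl (run_step m) 0"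

text \<open>For \<open>s \<le> m\<close> this is the Successor Infix Property. When the run is complete it has passed through \<open>-1\<close>
  and \<open>-0\<close>, which \<open>\<tau>\<close> contains only once and \<open>\<tau>'\<close> not at all.\<close>

lemma not_blocking_\<tau>:
  assumes split: "\<tau> @ \<tau>' = u @ t # r" and s: "1 \<le> reach u"
  shows "\<not> blocking m (reach u) t"
proof -
  have "t \<in> set (\<tau> @ \<tau>')" unfolding split by simp
  then obtain i where t: "t = NonPos i" using \<tau>_range \<tau>'_subset by auto
  \<comment> \<open>\<open>-1\<close> and \<open>-0\<close> occur at most once\<close>
  have once: "t \<notin> {NonPos 1, NonPos 0}" if "t \<in> set u"
  proof
    assume t01: "t \<in> {NonPos 1, NonPos 0}"
    then have "t \<notin> set \<tau>'" using \<tau>'_subset by auto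
    then show False
      using that split distinct by (auto simp: append_eq_append_conv2 append_eq_Cons_conv)
  qed
  show ?thesis
  proof (cases "reach u \<le> m")
    case True
    then show ?thesis
      using SIP_no_return[OF SIP_\<tau>[unfolded split] refl s True] by (auto simp: blocking_def t)
  next
    case False
    then have "NonPos (m - m) \<in> set u" "NonPos (m - (m - 1)) \<in> set u"
      by (intro run_mem_if_reached; simp)+
    then have "NonPos 0 \<in> set u" "NonPos 1 \<in> set u" using m by simp_all
    then have "i \<noteq> 0" "i \<noteq> 1" using once t by (metis insertCI)+
    then show ?thesis using False by (auto simp: blocking_def t)
  qed
qed

lemma one_le_reach: "1 \<le> reach \<tau>"
  using subseq_run_iff[of 0 1 m \<tau>] first by (simp add: subseq_singleton_left)

text \<open>When the search has reached \<open>s\<close>, the indices \<open>-m, \<dots>, -(m-s+1)\<close> lie in \<open>\<tau>\<close>, so \<open>m, \<dots>, m-s+1\<close> do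
  not lie in \<open>\<sigma>\<close>. If \<open>m-s\<close> were an entry of \<open>\<sigma>'\<close>, it would occur twice in \<open>(\<sigma>, \<sigma>')\<close>, and its successor
  \<open>m-s+1\<close> would have to occur in between.\<close>

lemma not_blocking_\<sigma>:
  assumes t: "t \<in> set \<sigma>'"
  shows "\<not> blocking m (reach \<tau>) t"
proof
  assume b: "blocking m (reach \<tau>) t"
  obtain i where i: "t = NonNeg i" using t \<sigma>'_subset \<sigma>_range by auto
  have t\<sigma>: "NonNeg i \<in> set \<sigma>" using t i \<sigma>'_subset by auto
  have reached: "NonNeg (m - j) \<notin> set \<sigma>" if "j < reach \<tau>" for j
    using run_mem_if_reached[OF that] disjoint by blast
  show False
  proof (cases "reach \<tau> \<le> m")
    case False
    then have "NonNeg (m - m) \<notin> set \<sigma>" "NonNeg (m - (m - 1)) \<notin> set \<sigma>"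
      by (intro reached; simp)+
    then show False using t\<sigma> b False m by (auto simp: blocking_def i)
  next
    case True
    have "m - (reach \<tau> - 1) = Suc (m - reach \<tau>)" using True one_le_reach by simp
    then have up: "NonNeg (Suc (m - reach \<tau>)) \<notin> set \<sigma>"
      using reached[of "reach \<tau> - 1"] one_le_reach by simp
    then have im: "i = m - reach \<tau>" using b t\<sigma> True by (auto simp: blocking_def i)
    obtain p v w q where "\<sigma> = p @ t # v" "\<sigma>' = w @ t # q"
      using t t\<sigma> i by (metis split_list)
    then have "\<sigma> @ \<sigma>' = p @ t # (v @ w) @ t # q" "set (v @ w) \<subseteq> set \<sigma>"
      using \<sigma>'_subset by auto
    then obtain y where "y \<in> set \<sigma>" "is_succ t y" using SIP_\<sigma> unfolding SIP_iff_split by blast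
    then show False using up im by (simp add: i)
  qed
qed

lemma elem_mat_P_regular:
  assumes "NonPos i \<in> set \<tau>"
  shows "elem_mat_P m n A (NonPos i) \<in> carrier_mat (m * n) (m * n)"
    and "i \<noteq> m \<Longrightarrow> det (elem_mat_P m n A (NonPos i)) \<noteq> 0"
proof -
  have i: "i \<le> m" using assms \<tau>_range by auto
  have "elem_mat_P m n A (NonPos i) \<in> carrier_mat (m * n) (m * n) \<and>
      (i \<noteq> m \<longrightarrow> det (elem_mat_P m n A (NonPos i)) \<noteq> 0)"
  proof (cases "i = 0")
    case True
    have A0c: "A 0 \<in> carrier_mat n n" using A by simp
    note E = inverse_M0[where A = A, OF m A0c A0[OF assms[unfolded True]]]
    show ?thesis using det_nonzero_if_inverse[OF E(3,1,5)] E(3) True by simp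
  next
    case False
    then have "elem_index m (NonPos i)" "A i \<in> carrier_mat n n" using i A by auto
    then show ?thesis
      unfolding elem_mat_P_NonPos[OF False]
      using elem_mat_carrier[OF m] det_elem_mat_nonzero[OF m, of "NonPos i" "A i" n] by auto
  qed
  then show "elem_mat_P m n A (NonPos i) \<in> carrier_mat (m * n) (m * n)"
    "i \<noteq> m \<Longrightarrow> det (elem_mat_P m n A (NonPos i)) \<noteq> 0" by blast+
qed

lemma elem_index_\<sigma>': "\<forall>i\<in>set \<sigma>'. elem_index m i"
  using \<sigma>'_subset \<sigma>_range by fastforce

lemma elem_index_\<tau>': "\<forall>i\<in>set \<tau>'. elem_index m i"
proof
  fix t assume "t \<in> set \<tau>'"
  then have "t \<in> NonPos ` {..m}" "t \<noteq> NonPos 0" using \<tau>'_subset \<tau>_range by auto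
  then show "elem_index m t" by auto
qed

text \<open>Let \<open>\<tau> = (a, -m, b)\<close>. Then the matrix in question is \<open>U' diag(A\<^sub>m, I) W\<close> with \<open>U'\<close> and \<open>W\<close>
  invertible, where \<open>W\<close> collects the factors to the right of \<open>M\<^sub>-\<^sub>m\<^sup>P\<close>. The first block row of \<open>W\<close> is
  found by reading these factors from left to right, starting at \<open>s = 1\<close> because \<open>-m\<close> has been met.\<close>

lemma basis_image:
  assumes U: "U \<in> carrier_mat (m * n) (m * n)" "det U \<noteq> 0"
    and Z: "basis_mat (m * n) Z
      (mat_kernel (U * tuple_mat_P m n A \<tau> * tuple_mat m n \<sigma>' X * tuple_mat m n \<tau>' Y))"
  shows "consecutions (NonPos m) \<tau> < int m \<Longrightarrow>
      basis_mat n (block_row m n (nat (consecutions (NonPos m) (\<tau> @ \<tau>') + 1)) * Z) (mat_kernel (A m))"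
    and "consecutions (NonPos m) \<tau> = int m \<Longrightarrow>
      basis_mat n (mat_inv (A 0) * (block_row m n m * Z)) (mat_kernel (A m))"
proof -
  let ?N = "m * n"
  let ?S = "tuple_mat m n \<sigma>' X" and ?T = "tuple_mat m n \<tau>' Y"
  let ?P = "\<lambda>ts. foldr (*) (map (elem_mat_P m n A) ts) (1\<^sub>m ?N)"
  have Am: "A m \<in> carrier_mat n n" using A by simp
  obtain a b where \<tau>: "\<tau> = a @ NonPos m # b" using split_list[OF first] by blast
  have a: "NonPos m \<notin> set a" and b: "NonPos m \<notin> set b" using distinct unfolding \<tau> by auto
  define D where "D = elem_mat m n (NonPos m) (A m)"
  have D: "elem_mat_P m n A (NonPos m) = D" using m by (simp add: D_def elem_mat_P_NonPos)
  have Pc: "set (map (elem_mat_P m n A) ts) \<subseteq> carrier_mat ?N ?N" if ts: "set ts \<subseteq> set \<tau>" for ts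
  proof
    fix E assume "E \<in> set (map (elem_mat_P m n A) ts)"
    then obtain i where "E = elem_mat_P m n A (NonPos i)" "NonPos i \<in> set \<tau>"
      using ts \<tau>_range by auto
    then show "E \<in> carrier_mat ?N ?N" using elem_mat_P_regular(1) by simp
  qed
  have Pd: "?P ts \<in> carrier_mat ?N ?N \<and> det (?P ts) \<noteq> 0" if ts: "set ts \<subseteq> set \<tau>" "NonPos m \<notin> set ts" for ts
  proof (intro conjI foldr_mult_carrier foldr_mult_det_nonzero Pc[OF ts(1)])
    fix E assume "E \<in> set (map (elem_mat_P m n A) ts)"
    then obtain t where t: "E = elem_mat_P m n A t" "t \<in> set ts" by auto
    moreover from this ts(1) \<tau>_range obtain i where "t = NonPos i" by auto
    ultimately have "E = elem_mat_P m n A (NonPos i)" "NonPos i \<in> set \<tau>" "i \<noteq> m" using ts by auto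
    then show "det E \<noteq> 0" using elem_mat_P_regular(2) by simp
  qed
  have Pa: "?P a \<in> carrier_mat ?N ?N" "det (?P a) \<noteq> 0"
    using Pd[of a] a by (simp_all add: \<tau> subset_iff)
  have Pb: "?P b \<in> carrier_mat ?N ?N" "det (?P b) \<noteq> 0"
    using Pd[of b] b by (simp_all add: \<tau> subset_iff)
  have Dc: "D \<in> carrier_mat ?N ?N" using elem_mat_P_regular(1)[OF first] by (simp only: D)
  have sub: "set a \<subseteq> set \<tau>" "set (NonPos m # b) \<subseteq> set \<tau>" by (auto simp: \<tau>)
  have P\<tau>: "tuple_mat_P m n A \<tau> = ?P a * (D * ?P b)"
    using foldr_mult_append[of "map (elem_mat_P m n A) a" ?N "map (elem_mat_P m n A) (NonPos m # b)"]
      Pc[OF sub(1)] Pc[OF sub(2)]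
    by (simp add: tuple_mat_P_def \<tau> D)
  note Sr = tuple_mat_regular[OF m elem_index_\<sigma>' X] and Tr = tuple_mat_regular[OF m elem_index_\<tau>' Y]
  define W where "W = ?P b * ?S * ?T"
  have W: "W \<in> carrier_mat ?N ?N" "det W \<noteq> 0"
    unfolding W_def using Pb Sr Tr by (auto simp: det_mult[of _ ?N])
  have Ua: "U * ?P a \<in> carrier_mat ?N ?N" "det (U * ?P a) \<noteq> 0"
    using U Pa by (auto simp: det_mult[of _ ?N])
  have K: "U * tuple_mat_P m n A \<tau> * ?S * ?T = (U * ?P a) * (D * W)"
    unfolding W_def P\<tau> using U(1) Pa(1) Pb(1) Dc Sr(2) Tr(2)
    by (simp add: assoc_mult_mat[of _ ?N ?N _ ?N _ ?N])
  \<comment> \<open>if \<open>-0\<close> is not in \<open>\<tau>\<close>, the run cannot be completed and the value of \<open>B\<close> is never seen\<close>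
  define B where "B = (if NonPos 0 \<in> set \<tau> then - mat_inv (A 0) else 0\<^sub>m n n)"
  have B: "B \<in> carrier_mat n n"
    using mat_inv_inverse(1)[of "A 0" n] A A0 by (auto simp: B_def)
  define R where "R = tracked_row m n B"
  have Rc: "R s \<in> carrier_mat n ?N" for s unfolding R_def by (rule tracked_row_carrier[OF B])
  have "reach a = 0"
    using subseq_run_iff[of 0 1 m a] a by (simp add: subseq_singleton_left)
  then have reach_a: "reach (a @ NonPos m # u) = foldl (run_step m) 1 u" for u
    by (simp add: run_step_def)
  \<comment> \<open>the walk through \<open>b\<close>, then through \<open>\<sigma>'\<close>, where the row stays in place, then through \<open>\<tau>'\<close>\<close>
  have 1: "R 1 * ?P b = R (reach \<tau>)"
    unfolding \<tau> reach_a
  proof (rule row_walk[OF _ Pc Rc])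
    fix u t r assume u: "b = u @ t # r"
    have split: "\<tau> @ \<tau>' = (a @ NonPos m # u) @ t # (r @ \<tau>')" by (simp add: \<tau> u)
    have s: "1 \<le> foldl (run_step m) 1 u" by (rule foldl_run_step_ge)
    have nb: "\<not> blocking m (foldl (run_step m) 1 u) t"
      using not_blocking_\<tau>[OF split] s unfolding reach_a by blast
    have t\<tau>: "t \<in> set \<tau>" by (simp add: \<tau> u)
    then obtain i where i: "t = NonPos i" "i \<le> m" using \<tau>_range by auto
    have "R (foldl (run_step m) 1 u) * elem_mat_P m n A t = R (run_step m (foldl (run_step m) 1 u) t)"
      unfolding R_def i(1)
      by (rule tracked_row_elem_mat_P[OF m i(2) A s nb[unfolded i(1)] _ _ B])
        (use A0 t\<tau> i in \<open>auto simp: B_def\<close>)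
    then show "R (foldl (run_step m) 1 u) * map (elem_mat_P m n A) b ! length u =
        R (run_step m (foldl (run_step m) 1 u) t)"
      by (simp add: u nth_append)
  qed (auto simp: \<tau>)
  have step: "R s * map2 (elem_mat m n) ts V ! length u = R (run_step m s t)"
    if ts: "ts = u @ t # r" "\<forall>i\<in>set ts. elem_index m i" and V: "nonsingular_assignment m n ts V"
      and s: "1 \<le> s" "\<not> blocking m s t" for s ts V u t r
  proof -
    have len: "length V = length ts" and Vc: "set V \<subseteq> carrier_mat n n"
      using V by (auto simp: nonsingular_assignment_def matrix_assignment_def)
    have l: "length u < length ts" using ts by simp
    then have "V ! length u \<in> carrier_mat n n" using Vc len by (metis nth_mem subsetD)
    moreover have "elem_index m t" using ts by simp
    ultimately have "R s * elem_mat m n t (V ! length u) = R (run_step m s t)"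
      unfolding R_def using tracked_row_elem_mat[OF m _ _ B s] by blast
    then show ?thesis using l len ts by simp
  qed
  have len: "length X = length \<sigma>'" "length Y = length \<tau>'"
    using X Y by (auto simp: nonsingular_assignment_def matrix_assignment_def)
  have NN: "set \<sigma>' \<subseteq> range NonNeg" using \<sigma>'_subset \<sigma>_range by auto
  have 2: "R (reach \<tau>) * ?S = R (reach \<tau>)"
  proof -
    have "R (reach \<tau>) * ?S = R (foldl (run_step m) (reach \<tau>) \<sigma>')"
      unfolding tuple_mat_def
    proof (rule row_walk[OF _ Sr(1) Rc])
      fix u t r assume u: "\<sigma>' = u @ t # r"
      have "set u \<subseteq> range NonNeg" using NN u by auto
      then have "foldl (run_step m) (reach \<tau>) u = reach \<tau>" by (rule foldl_run_step_NonNeg)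
      then show "R (foldl (run_step m) (reach \<tau>) u) * map2 (elem_mat m n) \<sigma>' X ! length u =
          R (run_step m (foldl (run_step m) (reach \<tau>) u) t)"
        using step[OF u elem_index_\<sigma>' X one_le_reach not_blocking_\<sigma>] u by simp
    qed (simp add: len)
    then show ?thesis using foldl_run_step_NonNeg[OF NN] by simp
  qed
  have 3: "R (reach \<tau>) * ?T = R (reach (\<tau> @ \<tau>'))"
    unfolding tuple_mat_def foldl_append
  proof (rule row_walk[OF _ Tr(1) Rc])
    fix u t r assume u: "\<tau>' = u @ t # r"
    have s: "1 \<le> foldl (run_step m) (reach \<tau>) u"
      using one_le_reach foldl_run_step_ge le_trans by blast
    have "\<not> blocking m (foldl (run_step m) (reach \<tau>) u) t"
      using not_blocking_\<tau>[of "\<tau> @ u" t r] s u by simp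
    then show "R (foldl (run_step m) (reach \<tau>) u) * map2 (elem_mat m n) \<tau>' Y ! length u =
        R (run_step m (foldl (run_step m) (reach \<tau>) u) t)"
      using step[OF u elem_index_\<tau>' Y s] by blast
  qed (simp add: len)
  have "R 1 * W = R 1 * ?P b * ?S * ?T"
    unfolding W_def using Rc[of 1] Pb(1) Sr(2) Tr(2)
    by (simp add: assoc_mult_mat[of _ n ?N _ ?N _ ?N] assoc_mult_mat[of _ ?N ?N _ ?N _ ?N])
  then have "R 1 * W = R (reach (\<tau> @ \<tau>'))" by (simp only: 1 2 3)
  then have row: "block_row m n 1 * W = R (reach (\<tau> @ \<tau>'))"
    using m by (simp add: R_def tracked_row_def)
  have Kc: "(U * ?P a) * (D * W) \<in> carrier_mat ?N ?N" using Ua Dc W by simp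
  have image: "basis_mat n (c \<cdot>\<^sub>m R (reach (\<tau> @ \<tau>')) * Z) (mat_kernel (A m))" if "c \<noteq> 0" for c
  proof (rule basis_mat_image[OF Kc Am])
    show "c \<cdot>\<^sub>m R (reach (\<tau> @ \<tau>')) \<in> carrier_mat n ?N" using Rc by simp
    show "bij_betw (\<lambda>v. (c \<cdot>\<^sub>m R (reach (\<tau> @ \<tau>'))) *\<^sub>v v) (mat_kernel (U * ?P a * (D * W))) (mat_kernel (A m))"
      using bij_betw_kernels[OF m Am Ua W that] by (simp only: row D_def)
    show "basis_mat ?N Z (mat_kernel (U * ?P a * (D * W)))" using Z by (simp only: K)
  qed
  show "basis_mat n (block_row m n (nat (consecutions (NonPos m) (\<tau> @ \<tau>') + 1)) * Z) (mat_kernel (A m))"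
    if "consecutions (NonPos m) \<tau> < int m"
  proof -
    have "reach \<tau> \<le> m" using that by (simp add: consecutions_eq_foldl)
    \<comment> \<open>\<open>\<tau>'\<close> does not contain \<open>-0\<close> and cannot complete the run\<close>
    then have "reach (\<tau> @ \<tau>') \<le> m" using foldl_run_step_le_m \<tau>'_subset by auto
    then have "1 \<cdot>\<^sub>m R (reach (\<tau> @ \<tau>')) = block_row m n (reach (\<tau> @ \<tau>'))"
      by (auto simp: R_def tracked_row_def)
    then show ?thesis using image[of 1] by (simp add: consecutions_eq_foldl)
  qed
  show "basis_mat n (mat_inv (A 0) * (block_row m n m * Z)) (mat_kernel (A m))"
    if "consecutions (NonPos m) \<tau> = int m"
  proof -
    have r: "reach \<tau> = Suc m" using that by (simp add: consecutions_eq_foldl)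
    then have "NonPos (m - m) \<in> set \<tau>" by (intro run_mem_if_reached) simp
    then have 0: "NonPos 0 \<in> set \<tau>" by simp
    have A0i: "mat_inv (A 0) \<in> carrier_mat n n" using mat_inv_inverse(1)[OF _ A0[OF 0]] A by simp
    have "reach (\<tau> @ \<tau>') = Suc m"
      using foldl_run_step_ge[of "Suc m" m \<tau>'] foldl_run_step_le[of "Suc m" m \<tau>'] by (simp add: r)
    \<comment> \<open>the scalar \<open>-1\<close> undoes the sign in \<open>M\<^sub>0\<^sup>P = M\<^sub>0(-A\<^sub>0)\<close>\<close>
    then have "(- 1) \<cdot>\<^sub>m R (reach (\<tau> @ \<tau>')) = (- 1) \<cdot>\<^sub>m (- mat_inv (A 0) * block_row m n m)"
      by (simp add: R_def tracked_row_def B_def 0)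
    also have "\<dots> = mat_inv (A 0) * block_row m n m"
      using A0i block_row_carrier[of m n m] by (intro eq_matI) auto
    finally have "(- 1) \<cdot>\<^sub>m R (reach (\<tau> @ \<tau>')) = mat_inv (A 0) * block_row m n m" .
    moreover have "Z \<in> carrier_mat ?N (dim_col Z)" using Z by (auto simp: basis_mat_def)
    ultimately show ?thesis
      using image[of "- 1"] assoc_mult_mat[OF A0i block_row_carrier] by simp
  qed
qed

end

section \<open>Transposition\<close>

lemma tuple_mat_transpose:
  assumes m: "m \<ge> 2" and t: "\<forall>i\<in>set t. elem_index m i" and X: "nonsingular_assignment m n t X"
  shows "(tuple_mat m n t X)\<^sup>T = tuple_mat m n (rev t) (map transpose_mat (rev X))"
proof -
  have len: "length X = length t" and Xc: "set X \<subseteq> carrier_mat n n"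
    using X by (auto simp: nonsingular_assignment_def matrix_assignment_def)
  have "map transpose_mat (map2 (elem_mat m n) t X) = map2 (elem_mat m n) t (map transpose_mat X)"
  proof (rule nth_equalityI)
    fix j assume "j < length (map transpose_mat (map2 (elem_mat m n) t X))"
    then have j: "j < length t" by simp
    then have "X ! j \<in> carrier_mat n n" "elem_index m (t ! j)" using Xc len t by (auto simp: subset_iff)
    then show "map transpose_mat (map2 (elem_mat m n) t X) ! j =
        map2 (elem_mat m n) t (map transpose_mat X) ! j"
      using j len elem_mat_transpose[OF m] by simp
  qed (simp add: len)
  then have "map transpose_mat (rev (map2 (elem_mat m n) t X)) =
      map2 (elem_mat m n) (rev t) (map transpose_mat (rev X))"
    by (metis len length_map rev_map zip_rev)
  then show ?thesis
    unfolding tuple_mat_def foldr_mult_transpose[OF tuple_mat_regular(1)[OF m t X]] by simp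
qed

lemma nonsingular_assignment_transpose:
  assumes "nonsingular_assignment m n t X"
  shows "nonsingular_assignment m n (rev t) (map transpose_mat (rev X))"
proof -
  have len: "length X = length t" and Xc: "set X \<subseteq> carrier_mat n n"
    and ns: "\<And>j. j < length t \<Longrightarrow> t ! j \<in> {NonNeg 0, NonPos 0, NonNeg m, NonPos m} \<Longrightarrow> invertible_mat (X ! j)"
    using assms by (auto simp: nonsingular_assignment_def matrix_assignment_def)
  have "invertible_mat (map transpose_mat (rev X) ! j)"
    if j: "j < length (rev t)" and tj: "rev t ! j \<in> {NonNeg 0, NonPos 0, NonNeg m, NonPos m}" for j
  proof -
    let ?k = "length t - Suc j"
    have k: "?k < length t" "rev t ! j = t ! ?k" "map transpose_mat (rev X) ! j = (X ! ?k)\<^sup>T"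
      using j len by (auto simp: rev_nth)
    have Xk: "X ! ?k \<in> carrier_mat n n" using Xc len k(1) by (metis nth_mem subsetD)
    have "det (X ! ?k) \<noteq> 0" using det_nonzero_if_invertible_mat[OF Xk] ns[OF k(1)] tj k(2) by simp
    then show ?thesis
      unfolding k(3) using invertible_mat_if_det_nonzero[of "(X ! ?k)\<^sup>T" n] Xk
      by (simp add: det_transpose[OF Xk])
  qed
  moreover have "set (map transpose_mat (rev X)) \<subseteq> carrier_mat n n" using Xc by auto
  ultimately show ?thesis
    unfolding nonsingular_assignment_def matrix_assignment_def using len by simp
qed

lemma elem_mat_P_transpose:
  assumes m: "m \<ge> 2" and A: "\<forall>i\<le>m. A i \<in> carrier_mat n n" and i: "i \<le> m"
    and d: "i = 0 \<Longrightarrow> det (A 0) \<noteq> 0"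
  shows "(elem_mat_P m n A (NonPos i))\<^sup>T = elem_mat_P m n (\<lambda>i. (A i)\<^sup>T) (NonPos i)"
proof (cases "i = 0")
  case False
  then have "elem_index m (NonPos i)" "A i \<in> carrier_mat n n" using i A by auto
  then show ?thesis unfolding elem_mat_P_NonPos[OF False] using elem_mat_transpose[OF m] by blast
next
  case True
  have A0: "A 0 \<in> carrier_mat n n" "- A 0 \<in> carrier_mat n n" using A by auto
  note E = inverse_M0[where A = A, OF m A0(1) d[OF True]]
  have t: "elem_index m (NonNeg 0)" using m by simp
  have "(- A 0)\<^sup>T = - (A 0)\<^sup>T" by (rule transpose_uminus)
  then have "(elem_mat m n (NonNeg 0) (- A 0))\<^sup>T = elem_mat m n (NonNeg 0) (- (A 0)\<^sup>T)"
    using elem_mat_transpose[OF m t A0(2)] by simp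
  then show ?thesis
    using mat_inv_transpose[OF E(1,2)] True by (simp add: elem_mat_P.simps)
qed

lemma (in fiedler_side) tuple_mat_P_carrier_transpose:
  shows "tuple_mat_P m n A \<tau> \<in> carrier_mat (m * n) (m * n)"
    and "(tuple_mat_P m n A \<tau>)\<^sup>T = tuple_mat_P m n (\<lambda>i. (A i)\<^sup>T) (rev \<tau>)"
proof -
  have E: "elem_mat_P m n A t \<in> carrier_mat (m * n) (m * n)"
    "(elem_mat_P m n A t)\<^sup>T = elem_mat_P m n (\<lambda>i. (A i)\<^sup>T) t" if t: "t \<in> set \<tau>" for t
  proof -
    obtain i where i: "t = NonPos i" "i \<le> m" using t \<tau>_range by auto
    show "elem_mat_P m n A t \<in> carrier_mat (m * n) (m * n)"
      using elem_mat_P_regular(1) t i by simp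
    show "(elem_mat_P m n A t)\<^sup>T = elem_mat_P m n (\<lambda>i. (A i)\<^sup>T) t"
      unfolding i(1) by (rule elem_mat_P_transpose[OF m A i(2)]) (use A0 t i in simp)
  qed
  then have c: "set (map (elem_mat_P m n A) \<tau>) \<subseteq> carrier_mat (m * n) (m * n)" by auto
  show "tuple_mat_P m n A \<tau> \<in> carrier_mat (m * n) (m * n)"
    unfolding tuple_mat_P_def by (rule foldr_mult_carrier[OF c])
  have "map transpose_mat (rev (map (elem_mat_P m n A) \<tau>)) =
      map (elem_mat_P m n (\<lambda>i. (A i)\<^sup>T)) (rev \<tau>)"
    using E(2) by (simp add: rev_map)
  then show "(tuple_mat_P m n A \<tau>)\<^sup>T = tuple_mat_P m n (\<lambda>i. (A i)\<^sup>T) (rev \<tau>)"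
    unfolding tuple_mat_P_def foldr_mult_transpose[OF c] by simp
qed

section \<open>Leading coefficients and eigenspaces at infinity\<close>

lemma const_mat_carrier: "B \<in> carrier_mat a b \<Longrightarrow> const_mat B \<in> carrier_mat a b"
  by (simp add: const_mat_def)

lemma coeff_mat_carrier: "Q \<in> carrier_mat a b \<Longrightarrow> coeff_mat Q i \<in> carrier_mat a b"
  by (simp add: coeff_mat_def)

lemma coeff_mat_const_mult:
  assumes B: "B \<in> carrier_mat a b" and Q: "Q \<in> carrier_mat b c"
  shows "coeff_mat (const_mat B * Q) i = B * coeff_mat Q i"
  using B Q by (intro eq_matI) (auto simp: coeff_mat_def const_mat_def scalar_prod_def coeff_sum intro!: sum.cong)

lemma coeff_mat_mult_const:
  assumes Q: "Q \<in> carrier_mat a b" and B: "B \<in> carrier_mat b c"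
  shows "coeff_mat (Q * const_mat B) i = coeff_mat Q i * B"
  using B Q by (intro eq_matI) (auto simp: coeff_mat_def const_mat_def scalar_prod_def coeff_sum mult.commute intro!: sum.cong)

lemma coeff_mat_pencil:
  assumes "S \<in> carrier_mat a b" "T \<in> carrier_mat a b"
  shows "coeff_mat ([:0, 1:] \<cdot>\<^sub>m const_mat T - const_mat S) 1 = T"
  using assms by (intro eq_matI) (auto simp: coeff_mat_def const_mat_def)

text \<open>The factors around the pencil are constant, so they pass through the coefficient of \<open>\<lambda>\<close>.\<close>

lemma coeff_mat_EGFP:
  assumes "tuple_mat m n \<tau>\<^sub>1 Y\<^sub>1 \<in> carrier_mat N N" "tuple_mat m n \<sigma>\<^sub>1 X\<^sub>1 \<in> carrier_mat N N"
    "tuple_mat_P m n A \<tau> \<in> carrier_mat N N" "tuple_mat_P m n A \<sigma> \<in> carrier_mat N N"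
    "tuple_mat m n \<sigma>\<^sub>2 X\<^sub>2 \<in> carrier_mat N N" "tuple_mat m n \<tau>\<^sub>2 Y\<^sub>2 \<in> carrier_mat N N"
  shows "EGFP m n A \<sigma> \<tau> \<sigma>\<^sub>1 \<sigma>\<^sub>2 \<tau>\<^sub>1 \<tau>\<^sub>2 X\<^sub>1 X\<^sub>2 Y\<^sub>1 Y\<^sub>2 \<in> carrier_mat N N"
    and "coeff_mat (EGFP m n A \<sigma> \<tau> \<sigma>\<^sub>1 \<sigma>\<^sub>2 \<tau>\<^sub>1 \<tau>\<^sub>2 X\<^sub>1 X\<^sub>2 Y\<^sub>1 Y\<^sub>2) 1 =
      tuple_mat m n \<tau>\<^sub>1 Y\<^sub>1 * tuple_mat m n \<sigma>\<^sub>1 X\<^sub>1 * tuple_mat_P m n A \<tau> *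
      tuple_mat m n \<sigma>\<^sub>2 X\<^sub>2 * tuple_mat m n \<tau>\<^sub>2 Y\<^sub>2"
proof -
  let ?T1 = "tuple_mat m n \<tau>\<^sub>1 Y\<^sub>1" and ?S1 = "tuple_mat m n \<sigma>\<^sub>1 X\<^sub>1"
  let ?Q = "[:0, 1:] \<cdot>\<^sub>m const_mat (tuple_mat_P m n A \<tau>) - const_mat (tuple_mat_P m n A \<sigma>)"
  note c = assms[THEN const_mat_carrier]
  have Q: "?Q \<in> carrier_mat N N" by (intro minus_carrier_mat c)
  have TSQ: "const_mat ?T1 * const_mat ?S1 * ?Q = const_mat ?T1 * (const_mat ?S1 * ?Q)"
    using c Q by (intro assoc_mult_mat) auto
  have SQ: "const_mat ?S1 * ?Q \<in> carrier_mat N N" using c Q by auto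
  note TSQc = mult_carrier_mat[OF c(1) SQ]
  note TSQSc = mult_carrier_mat[OF TSQc c(5)]
  show "EGFP m n A \<sigma> \<tau> \<sigma>\<^sub>1 \<sigma>\<^sub>2 \<tau>\<^sub>1 \<tau>\<^sub>2 X\<^sub>1 X\<^sub>2 Y\<^sub>1 Y\<^sub>2 \<in> carrier_mat N N"
    unfolding EGFP_def TSQ using mult_carrier_mat[OF TSQSc c(6)] .
  show "coeff_mat (EGFP m n A \<sigma> \<tau> \<sigma>\<^sub>1 \<sigma>\<^sub>2 \<tau>\<^sub>1 \<tau>\<^sub>2 X\<^sub>1 X\<^sub>2 Y\<^sub>1 Y\<^sub>2) 1 =
      ?T1 * ?S1 * tuple_mat_P m n A \<tau> * tuple_mat m n \<sigma>\<^sub>2 X\<^sub>2 * tuple_mat m n \<tau>\<^sub>2 Y\<^sub>2"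
    unfolding EGFP_def TSQ coeff_mat_mult_const[OF TSQSc assms(6)]
      coeff_mat_mult_const[OF TSQc assms(5)] coeff_mat_const_mult[OF assms(1) SQ]
      coeff_mat_const_mult[OF assms(2) Q] coeff_mat_pencil[OF assms(4,3)]
    using assoc_mult_mat[OF assms(1,2,3)] by simp
qed

lemma coeff_mat_poly:
  assumes "A m \<in> carrier_mat n n"
  shows "coeff_mat (mat_poly m n A) m = A m"
  using assms by (intro eq_matI) (auto simp: coeff_mat_def mat_poly_def coeff_sum coeff_monom)

text \<open>The reversed polynomial takes the value \<open>A\<^sub>m\<close> at \<open>0\<close>.\<close>

lemma infinite_eigenvalue_imp_det_zero:
  assumes Am: "A m \<in> carrier_mat n n" and inf: "infinite_eigenvalue m (mat_poly m n A)"
  shows "det (A m) = 0"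
proof -
  have "poly (\<Sum>i\<le>m. monom (coeff p (m - i)) i) 0 = coeff p m" for p :: "complex poly"
  proof -
    have "poly (\<Sum>i\<le>m. monom (coeff p (m - i)) i) 0 = (\<Sum>i\<le>m. if i = 0 then coeff p (m - i) else 0)"
      unfolding poly_sum poly_monom by (intro sum.cong) auto
    then show ?thesis by simp
  qed
  then have "map_mat (\<lambda>p. poly p 0) (rev_mat_poly m (mat_poly m n A)) = coeff_mat (mat_poly m n A) m"
    by (intro eq_matI) (auto simp: rev_mat_poly_def coeff_mat_def)
  then show ?thesis
    using inf coeff_mat_poly[where A = A, OF Am] by (simp add: infinite_eigenvalue_def mat_poly_eigenvalue_def)
qed

lemma left_kernel_eq_mat_kernel_transpose:
  assumes B: "B \<in> carrier_mat r c"
  shows "{x \<in> carrier_vec r. mat_of_row x * B = 0\<^sub>m 1 c} = mat_kernel (B\<^sup>T)"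
proof -
  have "mat_of_row x * B = 0\<^sub>m 1 c \<longleftrightarrow> B\<^sup>T *\<^sub>v x = 0\<^sub>v c" if x: "x \<in> carrier_vec r" for x
  proof -
    have e: "(mat_of_row x * B) $$ (0, j) = (B\<^sup>T *\<^sub>v x) $ j" if "j < c" for j
      using that B x comm_scalar_prod[OF x col_carrier_vec[OF that B]] by simp
    have "mat_of_row x * B = 0\<^sub>m 1 c \<longleftrightarrow> (\<forall>j<c. (mat_of_row x * B) $$ (0, j) = 0)"
      using B by (auto simp: mat_eq_iff)
    also have "\<dots> \<longleftrightarrow> (\<forall>j<c. (B\<^sup>T *\<^sub>v x) $ j = 0)" using e by simp
    also have "\<dots> \<longleftrightarrow> B\<^sup>T *\<^sub>v x = 0\<^sub>v c" using B by (auto simp: vec_eq_iff)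
    finally show ?thesis .
  qed
  then show ?thesis using B by (auto simp: mat_kernel[of "B\<^sup>T" c r])
qed

theorem theorem5p14:
  fixes m n k :: nat
    and A :: "nat \<Rightarrow> complex mat"
    and P L :: "complex poly mat"
    and \<sigma> \<tau> \<sigma>\<^sub>1 \<sigma>\<^sub>2 \<tau>\<^sub>1 \<tau>\<^sub>2 :: "tuple_index list"
    and X\<^sub>1 X\<^sub>2 Y\<^sub>1 Y\<^sub>2 :: "complex mat list"
    and Z :: "complex mat"
  assumes "m \<ge> 2"
    and "\<forall>i\<le>m. A i \<in> carrier_mat n n"
    and "A m \<noteq> 0\<^sub>m n n"
    and "P = mat_poly m n A"
    and "regular_mat_poly P"
    and "infinite_eigenvalue m P"
    and "EGFP_data m n A \<sigma> \<tau> \<sigma>\<^sub>1 \<sigma>\<^sub>2 \<tau>\<^sub>1 \<tau>\<^sub>2 X\<^sub>1 X\<^sub>2 Y\<^sub>1 Y\<^sub>2"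
    and "L = EGFP m n A \<sigma> \<tau> \<sigma>\<^sub>1 \<sigma>\<^sub>2 \<tau>\<^sub>1 \<tau>\<^sub>2 X\<^sub>1 X\<^sub>2 Y\<^sub>1 Y\<^sub>2"
    and "Z \<in> carrier_mat (m * n) k"
    and "vec_space.rank (m * n) Z = k"
  shows
    "(basis_mat (m * n) Z (right_eigenspace_inf 1 L) \<longrightarrow>
       (consecutions (NonPos m) \<tau> < int m \<longrightarrow>
          basis_mat n (block_row m n (nat (consecutions (NonPos m) (\<tau> @ \<tau>\<^sub>2) + 1)) * Z)
            (right_eigenspace_inf m P)) \<and>
       (consecutions (NonPos m) \<tau> = int m \<longrightarrow>
          basis_mat n (mat_inv (A 0) * (block_row m n m * Z)) (right_eigenspace_inf m P))) \<and>
     (basis_mat (m * n) Z (left_eigenspace_inf 1 L) \<longrightarrow>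
       (inversions (NonPos m) \<tau> < int m \<longrightarrow>
          basis_mat n (block_row m n (nat (inversions (NonPos m) (\<tau>\<^sub>1 @ \<tau>) + 1)) * Z)
            (left_eigenspace_inf m P)) \<and>
       (inversions (NonPos m) \<tau> = int m \<longrightarrow>
          basis_mat n (transpose_mat (mat_inv (A 0)) * (block_row m n m * Z))
            (left_eigenspace_inf m P)))"
proof -
  let ?N = "m * n"
  let ?T1 = "tuple_mat m n \<tau>\<^sub>1 Y\<^sub>1" and ?S1 = "tuple_mat m n \<sigma>\<^sub>1 X\<^sub>1"
    and ?S2 = "tuple_mat m n \<sigma>\<^sub>2 X\<^sub>2" and ?T2 = "tuple_mat m n \<tau>\<^sub>2 Y\<^sub>2"
  let ?M\<tau> = "tuple_mat_P m n A \<tau>"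
  let ?At = "\<lambda>i. (A i)\<^sup>T"
  note m = assms(1) and A = assms(2)
  have Am: "A m \<in> carrier_mat n n" and A0: "A 0 \<in> carrier_mat n n" using A by auto
  obtain \<omega> where \<omega>: "\<tau> = map neg_index \<omega>" "distinct (\<sigma> @ \<omega>)" "set (\<sigma> @ \<omega>) = NonNeg ` {0..m}"
    and inv0: "NonPos 0 \<in> set \<tau> \<Longrightarrow> invertible_mat (A 0)"
    and invm: "NonNeg m \<in> set \<sigma> \<Longrightarrow> invertible_mat (A m)"
    and \<sigma>12: "set \<sigma>\<^sub>1 \<subseteq> set \<sigma>" "set \<sigma>\<^sub>2 \<subseteq> set \<sigma>"
    and S\<sigma>: "SIP (\<sigma>\<^sub>1 @ \<sigma> @ \<sigma>\<^sub>2)"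
    and \<tau>12: "set \<tau>\<^sub>1 \<subseteq> set \<tau> - {NonPos 1, NonPos 0}" "set \<tau>\<^sub>2 \<subseteq> set \<tau> - {NonPos 1, NonPos 0}"
    and S\<tau>: "SIP (\<tau>\<^sub>1 @ \<tau> @ \<tau>\<^sub>2)"
    and X1: "nonsingular_assignment m n \<sigma>\<^sub>1 X\<^sub>1" and X2: "nonsingular_assignment m n \<sigma>\<^sub>2 X\<^sub>2"
    and Y1: "nonsingular_assignment m n \<tau>\<^sub>1 Y\<^sub>1" and Y2: "nonsingular_assignment m n \<tau>\<^sub>2 Y\<^sub>2"
    using assms(7) unfolding EGFP_data_def by blast
  have "det (A m) = 0" using infinite_eigenvalue_imp_det_zero[where A = A, OF Am] assms(4,6) by simp
  then have m\<sigma>: "NonNeg m \<notin> set \<sigma>" using invm det_nonzero_if_invertible_mat[OF Am] by blast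
  have \<sigma>r: "set \<sigma> \<subseteq> NonNeg ` {..<m}"
  proof
    fix t assume t: "t \<in> set \<sigma>"
    then have "t \<in> NonNeg ` {0..m}" unfolding \<omega>(3)[symmetric] by simp
    moreover have "t \<noteq> NonNeg m" using t m\<sigma> by blast
    ultimately show "t \<in> NonNeg ` {..<m}" by (auto simp: le_less)
  qed
  have \<omega>r: "set \<omega> \<subseteq> NonNeg ` {..m}" using \<omega>(3) unfolding atMost_atLeast0 by auto
  have mem_\<tau>: "NonPos i \<in> set \<tau> \<longleftrightarrow> NonNeg i \<in> set \<omega>" for i
    using \<omega>r unfolding \<omega>(1) by (auto simp: image_iff) force+
  have \<tau>r: "set \<tau> \<subseteq> NonPos ` {..m}" using \<omega>r unfolding \<omega>(1) by auto
  have "neg_index (neg_index t) = t" for t by (cases t) simp_all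
  then have "inj_on neg_index (set \<omega>)" by (metis inj_onI)
  then have dist: "distinct \<tau>" using \<omega>(2) unfolding \<omega>(1) by (simp add: distinct_map)
  have first: "NonPos m \<in> set \<tau>"
    unfolding mem_\<tau> using \<omega>(3) m\<sigma> by (metis Un_iff atLeastAtMost_iff imageI le_refl le0 set_append)
  have disj: "NonPos i \<in> set \<tau> \<Longrightarrow> NonNeg i \<notin> set \<sigma>" for i
    using \<omega>(2) unfolding mem_\<tau> by auto
  have det0: "NonPos 0 \<in> set \<tau> \<Longrightarrow> det (A 0) \<noteq> 0"
    using inv0 det_nonzero_if_invertible_mat[OF A0] by blast
  \<comment> \<open>the right-hand side of the pencil, and the transposed left-hand side\<close>
  interpret R: fiedler_side m n A \<sigma> \<tau> \<sigma>\<^sub>2 \<tau>\<^sub>2 X\<^sub>2 Y\<^sub>2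
    using m A dist first \<tau>r \<sigma>r disj det0 \<sigma>12(2) \<tau>12(2) SIP_appendD(1)[OF S\<sigma>] SIP_appendD(1)[OF S\<tau>] X2 Y2
    by unfold_locales
  have S\<sigma>': "SIP (rev \<sigma> @ rev \<sigma>\<^sub>1)" and S\<tau>': "SIP (rev \<tau> @ rev \<tau>\<^sub>1)"
    using SIP_rev[OF SIP_appendD(2)[of "\<sigma>\<^sub>1 @ \<sigma>" \<sigma>\<^sub>2]] SIP_rev[OF SIP_appendD(2)[of "\<tau>\<^sub>1 @ \<tau>" \<tau>\<^sub>2]] S\<sigma> S\<tau>
    by simp_all
  interpret T: fiedler_side m n ?At "rev \<sigma>" "rev \<tau>" "rev \<sigma>\<^sub>1" "rev \<tau>\<^sub>1"
    "map transpose_mat (rev X\<^sub>1)" "map transpose_mat (rev Y\<^sub>1)"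
    using m A dist first \<tau>r \<sigma>r disj det0 det_transpose[OF A0] \<sigma>12(1) \<tau>12(1) S\<sigma>' S\<tau>'
      nonsingular_assignment_transpose[OF X1] nonsingular_assignment_transpose[OF Y1]
    by unfold_locales simp_all
  have ix: "\<forall>i\<in>set \<sigma>\<^sub>1. elem_index m i" "\<forall>i\<in>set \<tau>\<^sub>1. elem_index m i"
    using T.elem_index_\<sigma>' T.elem_index_\<tau>' by simp_all
  note S1 = tuple_mat_regular(2,3)[OF m ix(1) X1] and T1 = tuple_mat_regular(2,3)[OF m ix(2) Y1]
    and S2 = tuple_mat_regular(2,3)[OF m R.elem_index_\<sigma>' X2]
    and T2 = tuple_mat_regular(2,3)[OF m R.elem_index_\<tau>' Y2]
  note M\<tau> = R.tuple_mat_P_carrier_transpose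
  have "elem_mat_P m n A t \<in> carrier_mat ?N ?N" if t: "t \<in> set \<sigma>" for t
  proof -
    obtain i where i: "t = NonNeg i" "i < m" using t \<sigma>r by auto
    then have "elem_mat_P m n A t = elem_mat m n (NonNeg i) (- A i)" by (simp add: elem_mat_P.simps)
    then show ?thesis using elem_mat_carrier[OF m, of "NonNeg i" "- A i" n] i A by simp
  qed
  then have M\<sigma>: "tuple_mat_P m n A \<sigma> \<in> carrier_mat ?N ?N"
    unfolding tuple_mat_P_def by (intro foldr_mult_carrier) auto
  let ?K = "?T1 * ?S1 * ?M\<tau> * ?S2 * ?T2"
  have L: "L \<in> carrier_mat ?N ?N" "coeff_mat L 1 = ?K"
    unfolding assms(8) using coeff_mat_EGFP[OF T1(1) S1(1) M\<tau>(1) M\<sigma> S2(1) T2(1)] by simp_all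
  have Kc: "?K \<in> carrier_mat ?N ?N" using coeff_mat_carrier[OF L(1), of 1] unfolding L(2) .
  have P: "P \<in> carrier_mat n n" "coeff_mat P m = A m"
    unfolding assms(4) using coeff_mat_poly[where A = A, OF Am] by (auto simp: mat_poly_def)
  have right: "right_eigenspace_inf 1 L = mat_kernel ?K" "right_eigenspace_inf m P = mat_kernel (A m)"
    unfolding right_eigenspace_inf_def using L P by simp_all
  have U: "?T1 * ?S1 \<in> carrier_mat ?N ?N" "det (?T1 * ?S1) \<noteq> 0"
    using S1 T1 by (auto simp: det_mult[of _ ?N])
  have left: "left_eigenspace_inf 1 L = mat_kernel (?K\<^sup>T)" "left_eigenspace_inf m P = mat_kernel ((A m)\<^sup>T)"
    unfolding left_eigenspace_inf_def
    using L P left_kernel_eq_mat_kernel_transpose[OF Kc] left_kernel_eq_mat_kernel_transpose[OF Am] by simp_all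
  have V: "?T2\<^sup>T * ?S2\<^sup>T \<in> carrier_mat ?N ?N" "det (?T2\<^sup>T * ?S2\<^sup>T) \<noteq> 0"
    using S2 T2 by (auto simp: det_mult[of _ ?N] det_transpose[of _ ?N])
  note TSM = mult_carrier_mat[OF U(1) M\<tau>(1)]
  note TSMS = mult_carrier_mat[OF TSM S2(1)]
  have "?K\<^sup>T = ?T2\<^sup>T * (?S2\<^sup>T * (?M\<tau>\<^sup>T * (?S1\<^sup>T * ?T1\<^sup>T)))"
    unfolding transpose_mult[OF TSMS T2(1)] transpose_mult[OF TSM S2(1)]
      transpose_mult[OF U(1) M\<tau>(1)] transpose_mult[OF T1(1) S1(1)] ..
  also have "\<dots> = ?T2\<^sup>T * ?S2\<^sup>T * ?M\<tau>\<^sup>T * ?S1\<^sup>T * ?T1\<^sup>T"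
    using S1 T1 S2 T2 M\<tau>(1) by (simp add: assoc_mult_mat[of _ ?N ?N _ ?N _ ?N])
  also have "\<dots> = ?T2\<^sup>T * ?S2\<^sup>T * tuple_mat_P m n ?At (rev \<tau>) *
      tuple_mat m n (rev \<sigma>\<^sub>1) (map transpose_mat (rev X\<^sub>1)) *
      tuple_mat m n (rev \<tau>\<^sub>1) (map transpose_mat (rev Y\<^sub>1))"
    by (simp only: M\<tau>(2) tuple_mat_transpose[OF m ix(1) X1] tuple_mat_transpose[OF m ix(2) Y1])
  finally have KT: "?K\<^sup>T = \<dots>" .
  \<comment> \<open>the run is complete, so \<open>-0\<close> is in \<open>\<tau>\<close> and \<open>A\<^sub>0\<close> is invertible\<close>
  have inv: "mat_inv (A 0)\<^sup>T = (mat_inv (A 0))\<^sup>T" if "inversions (NonPos m) \<tau> = int m"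
  proof -
    have "foldl (run_step m) 0 (rev \<tau>) = Suc m"
      using that by (simp add: inversions_eq_consecutions_rev consecutions_eq_foldl)
    then have "NonPos (m - m) \<in> set (rev \<tau>)" by (intro run_mem_if_reached) simp
    then show ?thesis using mat_inv_transpose[OF A0 det0] by simp
  qed
  show ?thesis
    unfolding right left
    using R.basis_image[OF U] T.basis_image[OF V, folded KT] inv
    by (simp add: inversions_eq_consecutions_rev)
qed

end
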